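(* Let $n\geq 3$, and let $\mathrm{GCB}(m)$ and $\mathrm{GCD}(m)$ be the lists defined below. If $\mathrm{GCD}(n-2)$ (a list of every involution of $\mathcal{S}^D_{n-2}$ exactly once) and $\mathrm{GCB}(n-1)$ (a list of every involution of $\mathcal{S}^B_{n-1}$ exactly once) satisfy properties A1 and A2, then $\mathrm{GCD}(n)$ contains every involution of $\mathcal{S}_n^D$ exactly once, satisfies properties A1 and A2, and is cyclic (its first element is obtained from its last element in the manner described in A2).
   Context: $\overline{i}=-i$. $\mathcal{S}_n^B$ is the group of permutations $\pi$ of $\{\pm1,\dots,\pm n\}$ with $\pi(\overline i)=\overline{\pi(i)}$, in one-line notation $\pi(1)\cdots\pi(n)$; $\mathcal{S}_n^D$ is the subgroup of those with an even number of negative entries. Involutions over an alphabet $N$ of positive integers are negation-commuting involutive permutations of $\pm N$ (type $D$: even number of negative entries), written in one-line notation with positions indexed by $N$ increasingly. Cycle notation: for positive $i\neq j$, $(i\,j)$ swaps $i\leftrightarrow j$, $\overline i\leftrightarrow\overline j$; $(\overline i\,\overline j)$ swaps $i\leftrightarrow\overline j$, $\overline i\leftrightarrow j$; $(\overline j)$ swaps $j\leftrightarrow\overline j$; $\mathrm{id}$ is the identity. List operations for $L=(w_1,\dots,w_m)$ over $N$: $\overleftarrow L$ is the reversal; for $k\notin N$, $L\cdot k$ extends each $w_\ell$ fixing $k$, $L\cdot\overline k$ extends each by composing with $(\overline k)$, and $L\cdot\widetilde k$ extends $w_\ell$ by $k$ fixed if $w_\ell$ has an even number of negative entries and by $(\overline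 k)$ otherwise; for $i,j\notin N$, $L\cdot(i\,j)$, $L\cdot(\overline i\,\overline j)$ compose each element with that disjoint transposition. For a bijection $F:[r]\to N$ written $F=F(1)\cdots F(r)$, $w^F$ is the involution over $N$ with $w^F(F(i))=F(w(i))$, $F(\overline j):=\overline{F(j)}$; $L^F=(w_\ell^F)_\ell$ and $\overleftarrow L^F$ its reversal. Type $B$ lists: $\mathrm{GCB}(2)=(\mathrm{id},(\overline1),(\overline1)(\overline2),(\overline2),(\overline1\,\overline2),(1\,2))$; $\mathrm{GCB}(3)=(\mathrm{id},(\overline1),(\overline1)(\overline2),(\overline2),(\overline1\,\overline2),(1\,2),(1\,2)(\overline3),(\overline1\,\overline2)(\overline3),(\overline2)(\overline3),(\overline1)(\overline2)(\overline3),(\overline1)(\overline3),(\overline3),(\overline1\,\overline3),(\overline1\,\overline3)(\overline2),(1\,3)(\overline2),(1\,3),(2\,3),(\overline1)(2\,3),(\overline1)(\overline2\,\overline3),(\overline2\,\overline3))$; for $m\geq4$, $\mathrm{GCB}(m)$ is the concatenation of $\mathrm{GCB}(m-1)\cdot m$, $\overleftarrow{\mathrm{GCB}}(m-1)\cdot\overline m$, and for $i=1,\dots,m-1$ in order, with $F_i=1\cdots(i-1)(i+1)\cdots(m-1)$: if $i$ odd, $\mathrm{GCB}(m-2)^{F_i}\cdot(\overline i\,\overline m)$ then $\overleftarrow{\mathrm{GCB}}(m-2)^{F_i}\cdot(i\,m)$; if $i$ even, $\mathrm{GCB}(m-2)^{F_i}\cdot(i\,m)$ then $\overleftarrow{\mathrm{GCB}}(m-2)^{F_i}\cdot(\overline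 i\,\overline m)$. Type $D$ lists: $\mathrm{GCD}(1)=(\mathrm{id})$, $\mathrm{GCD}(2)=(\mathrm{id},(\overline1)(\overline2),(\overline1\,\overline2),(1\,2))$; for $n\geq3$, $\mathrm{GCD}(n)$ is the concatenation of $\mathrm{GCB}(n-1)^{F_0}\cdot\widetilde n$ with $F_0=2\,3\cdots(n-1)\,1$, followed, for $i=1,\dots,n-1$ in order, with $F_i=1\cdots(i-1)(i+1)\cdots(n-1)$, by $\mathrm{GCD}(n-2)^{F_i}\cdot(i\,n)$ and then $\overleftarrow{\mathrm{GCD}}(n-2)^{F_i}\cdot(\overline i\,\overline n)$. Property A1 (for a list of involutions over $[n]$): the first element is $\mathrm{id}$ and the last is $(n-1\;n)$ or $(\overline{n-1}\;\overline n)$. Property A2: each element is obtained from its predecessor, in one-line notation, by one of: (i) exchanging the entries in two positions, or (ii) cyclically rotating the entries in three positions, in either case possibly also changing the signs of at most two entries; or (iii) changing the signs of one or two entries. *)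

theory Defs
  imports Main "HOL-Combinatorics.Permutations"
begin

text \<open>
  Signed permutations over a finite alphabet \<open>N\<close> of positive integers are represented as functions
  \<open>int \<Rightarrow> int\<close> that are the identity outside \<open>\<plusminus>N\<close>. Under this convention extending a signed permutation
  by a fixed letter \<open>k \<notin> N\<close> does not change the underlying function, so \<open>L \<cdot> k\<close> is just \<open>L\<close>.
\<close>

definition signed_alphabet :: "int set \<Rightarrow> int set" where
  "signed_alphabet N = N \<union> uminus ` N"

definition signed_perms :: "int set \<Rightarrow> (int \<Rightarrow> int) set" where
  "signed_perms N = {w. w permutes signed_alphabet N \<and> (\<forall>i. w (- i) = - w i)}"

text \<open>Number of negative entries in one-line notation; finite because \<open>w\<close> fixes all letters outside \<open>\<plusminus>N\<close>.\<close>

definition neg_count :: "(int \<Rightarrow> int) \<Rightarrow> nat" where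
  "neg_count w = card {i. 0 < i \<and> w i < 0}"

definition SB :: "nat \<Rightarrow> (int \<Rightarrow> int) set" where
  "SB n = signed_perms {1..int n}"

definition SD :: "nat \<Rightarrow> (int \<Rightarrow> int) set" where
  "SD n = {w \<in> SB n. even (neg_count w)}"

definition involutions_in :: "(int \<Rightarrow> int) set \<Rightarrow> (int \<Rightarrow> int) set" where
  "involutions_in G = {w \<in> G. w \<circ> w = id}"


text \<open>The cycles \<open>(i j)\<close>, \<open>(-i -j)\<close> and \<open>(-j)\<close>. Note that \<open>(-i -j)\<close> exchanges \<open>i\<close> with \<open>-j\<close>.\<close>

definition cyc :: "int \<Rightarrow> int \<Rightarrow> int \<Rightarrow> int" where
  "cyc i j = transpose i j \<circ> transpose (- i) (- j)"

definition cyc_bar :: "int \<Rightarrow> int \<Rightarrow> int \<Rightarrow> int" where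
  "cyc_bar i j = transpose i (- j) \<circ> transpose (- i) j"

definition neg :: "int \<Rightarrow> int \<Rightarrow> int" where
  "neg j = transpose j (- j)"


definition mult_all :: "(int \<Rightarrow> int) list \<Rightarrow> (int \<Rightarrow> int) \<Rightarrow> (int \<Rightarrow> int) list" (infixl "\<cdot>" 70) where
  "L \<cdot> t = map (\<lambda>w. w \<circ> t) L"

definition ext_even :: "(int \<Rightarrow> int) list \<Rightarrow> int \<Rightarrow> (int \<Rightarrow> int) list" where
  "ext_even L k = map (\<lambda>w. if even (neg_count w) then w else w \<circ> neg k) L"

text \<open>
  A bijection \<open>F : [r] \<rightarrow> N\<close> is given by the word \<open>F(1) \<dots> F(r)\<close>; \<open>word_map F\<close> is its odd extension
  to \<open>\<plusminus>[r]\<close>.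
\<close>

definition word_map :: "int list \<Rightarrow> int \<Rightarrow> int" where
  "word_map F i = (if 0 < i then F ! nat (i - 1) else - (F ! nat (- i - 1)))"

definition relabel :: "int list \<Rightarrow> (int \<Rightarrow> int) \<Rightarrow> int \<Rightarrow> int" where
  "relabel F w x =
    (if x \<in> signed_alphabet (set F)
     then word_map F (w (inv_into (signed_alphabet {1..int (length F)}) (word_map F) x))
     else x)"

definition skip_word :: "int \<Rightarrow> int \<Rightarrow> int list" where
  "skip_word m i = [1..i - 1] @ [i + 1..m - 1]"


text \<open>The lists are not defined for \<open>GCB_list 0\<close>, \<open>GCB_list 1\<close> and \<open>GCD_list 0\<close>; the value \<open>[]\<close> is a dummy.\<close>

function GCB_list :: "nat \<Rightarrow> (int \<Rightarrow> int) list" where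
  "GCB_list m =
    (if m < 2 then []
     else if m = 2 then
       [id, neg 1, neg 1 \<circ> neg 2, neg 2, cyc_bar 1 2, cyc 1 2]
     else if m = 3 then
       [id, neg 1, neg 1 \<circ> neg 2, neg 2, cyc_bar 1 2, cyc 1 2,
        cyc 1 2 \<circ> neg 3, cyc_bar 1 2 \<circ> neg 3, neg 2 \<circ> neg 3, neg 1 \<circ> neg 2 \<circ> neg 3,
        neg 1 \<circ> neg 3, neg 3, cyc_bar 1 3, cyc_bar 1 3 \<circ> neg 2, cyc 1 3 \<circ> neg 2, cyc 1 3,
        cyc 2 3, neg 1 \<circ> cyc 2 3, neg 1 \<circ> cyc_bar 2 3, cyc_bar 2 3]
     else
       GCB_list (m - 1) @ rev (GCB_list (m - 1)) \<cdot> neg (int m) @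
       concat (map (\<lambda>i.
         let L = map (relabel (skip_word (int m) i)) (GCB_list (m - 2)) in
         if odd i then L \<cdot> cyc_bar i (int m) @ rev L \<cdot> cyc i (int m)
         else L \<cdot> cyc i (int m) @ rev L \<cdot> cyc_bar i (int m))
       [1..int m - 1]))"
  by pat_completeness auto
termination by (relation "measure id") auto

function GCD_list :: "nat \<Rightarrow> (int \<Rightarrow> int) list" where
  "GCD_list n =
    (if n = 0 then []
     else if n = 1 then [id]
     else if n = 2 then [id, neg 1 \<circ> neg 2, cyc_bar 1 2, cyc 1 2]
     else
       ext_even (map (relabel ([2..int n - 1] @ [1])) (GCB_list (n - 1))) (int n) @
       concat (map (\<lambda>i.
         let L = map (relabel (skip_word (int n) i)) (GCD_list (n - 2)) in
         L \<cdot> cyc i (int n) @ rev L \<cdot> cyc_bar i (int n))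
       [1..int n - 1]))"
  by pat_completeness auto
termination by (relation "measure id") auto

text \<open>The unconditional equations would make the simplifier loop.\<close>

declare GCB_list.simps [simp del] GCD_list.simps [simp del]


definition lists_exactly_once :: "'a list \<Rightarrow> 'a set \<Rightarrow> bool" where
  "lists_exactly_once L A \<longleftrightarrow> distinct L \<and> set L = A"

text \<open>
  For \<open>n = 1\<close> there is no letter \<open>n - 1\<close>, so the cycles required of the last element do not exist and the
  condition on it is void. This is what allows \<open>GCD_list 1 = [id]\<close> to have the property.
\<close>

definition property_A1 :: "nat \<Rightarrow> (int \<Rightarrow> int) list \<Rightarrow> bool" where
  "property_A1 n L \<longleftrightarrow>
    L \<noteq> [] \<and> hd L = id \<and>
    (2 \<le> n \<longrightarrow> last L = cyc (int n - 1) (int n) \<or> last L = cyc_bar (int n - 1) (int n))"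

definition one_line :: "nat \<Rightarrow> (int \<Rightarrow> int) \<Rightarrow> int list" where
  "one_line n w = map w [1..int n]"

definition exchange :: "nat \<Rightarrow> nat \<Rightarrow> 'a list \<Rightarrow> 'a list" where
  "exchange p q xs = xs[p := xs ! q, q := xs ! p]"

definition rotate3 :: "nat \<Rightarrow> nat \<Rightarrow> nat \<Rightarrow> 'a list \<Rightarrow> 'a list" where
  "rotate3 p q r xs = xs[p := xs ! q, q := xs ! r, r := xs ! p]"

definition change_signs :: "nat set \<Rightarrow> int list \<Rightarrow> int list" where
  "change_signs S xs = map (\<lambda>p. if p \<in> S then - (xs ! p) else xs ! p) [0..<length xs]"

text \<open>
  The entries whose signs change need not be among those that move. Both directions of rotation are
  covered, since the positions \<open>p\<close>, \<open>q\<close>, \<open>r\<close> are not assumed to be in increasing order.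
\<close>

definition A2_step :: "int list \<Rightarrow> int list \<Rightarrow> bool" where
  "A2_step xs ys \<longleftrightarrow>
    (\<exists>p < length xs. \<exists>q < length xs. \<exists>S \<subseteq> {..<length xs}.
       p \<noteq> q \<and> card S \<le> 2 \<and> ys = change_signs S (exchange p q xs)) \<or>
    (\<exists>p < length xs. \<exists>q < length xs. \<exists>r < length xs. \<exists>S \<subseteq> {..<length xs}.
       distinct [p, q, r] \<and> card S \<le> 2 \<and> ys = change_signs S (rotate3 p q r xs)) \<or>
    (\<exists>S \<subseteq> {..<length xs}. card S \<in> {1, 2} \<and> ys = change_signs S xs)"

definition property_A2 :: "nat \<Rightarrow> (int \<Rightarrow> int) list \<Rightarrow> bool" where
  "property_A2 n L \<longleftrightarrow> successively (\<lambda>u v. A2_step (one_line n u) (one_line n v)) L"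

definition cyclic_A2 :: "nat \<Rightarrow> (int \<Rightarrow> int) list \<Rightarrow> bool" where
  "cyclic_A2 n L \<longleftrightarrow> L \<noteq> [] \<and> A2_step (one_line n (last L)) (one_line n (hd L))"

end

theory Submission imports Defs begin

text \<open>
  An involution \<open>w\<close> in \<open>SD n\<close> is determined by \<open>w n\<close> and an involution on the remaining letters. If
  \<open>w n = \<plusminus>n\<close>, the latter is an arbitrary type B involution of \<open>[n - 1]\<close>, its parity fixing the sign; if
  \<open>w n = \<plusminus>i\<close> with \<open>i < n\<close>, it is a type D involution of \<open>[n] - {i, n}\<close>. The blocks of \<open>GCD_list n\<close> are
  the fibres of \<open>w \<mapsto> \<bar>w n\<bar>\<close>.

  A step of A2 is right multiplication by a signed permutation with at most two signs whose
  underlying permutation is a transposition, a 3-cycle or the identity. In this form steps are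
  visibly reversible and survive relabelling and composition with disjoint cycles. The steps
  between consecutive blocks are 3-rotations, with the relabelling \<open>2 3 \<dots> (n-1) 1\<close> placing the
  first block's last element next to \<open>(1 n)\<close>.
\<close>

section \<open>Signed involutions over an alphabet and their numbers of negative entries\<close>

text \<open>The alphabet is a parameter because the blocks use involutions on \<open>[n]\<close>
  with one or two letters removed. Since all functions are the identity outside \<plusminus>N,
  involutions over different alphabets can be compared and composed directly.\<close>

definition invs :: "int set \<Rightarrow> (int \<Rightarrow> int) set" where
  "invs N = involutions_in (signed_perms N)"

lemma uminus_in_signed_alphabet [simp]: "- x \<in> signed_alphabet N \<longleftrightarrow> x \<in> signed_alphabet N"
  by (force simp: signed_alphabet_def image_iff)

lemma signed_alphabet_altdef: "x \<in> signed_alphabet N \<longleftrightarrow> x \<in> N \<or> - x \<in> N"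
  by (force simp: signed_alphabet_def image_iff)

text \<open>Bijectivity comes for free, since an involution is its own inverse; only pointwise
  equations remain to be checked.\<close>

lemma invs_iff:
  "w \<in> invs N \<longleftrightarrow> (\<forall>x. w (- x) = - w x) \<and> (\<forall>x. w (w x) = x) \<and> (\<forall>x. x \<notin> signed_alphabet N \<longrightarrow> w x = x)"
proof -
  have "w permutes signed_alphabet N" if "\<forall>x. w (w x) = x" "\<forall>x. x \<notin> signed_alphabet N \<longrightarrow> w x = x"
    using that unfolding permutes_def by metis
  then show ?thesis
    by (auto simp: invs_def involutions_in_def signed_perms_def fun_eq_iff permutes_def)
qed

lemma invs_SB: "involutions_in (SB n) = invs {1..int n}"
  by (simp add: invs_def SB_def)

lemma invs_SD: "involutions_in (SD n) = {w \<in> invs {1..int n}. even (neg_count w)}"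
  by (auto simp: invs_def SB_def SD_def involutions_in_def)

lemma invs_odd: "w \<in> invs N \<Longrightarrow> w (- x) = - w x"
  and invs_invol: "w \<in> invs N \<Longrightarrow> w (w x) = x"
  and invs_fix: "w \<in> invs N \<Longrightarrow> x \<notin> signed_alphabet N \<Longrightarrow> w x = x"
  by (auto simp: invs_iff)

lemma invs_in: "w \<in> invs N \<Longrightarrow> w x \<in> signed_alphabet N \<longleftrightarrow> x \<in> signed_alphabet N"
  by (metis invs_iff)

text \<open>Oddness forces \<open>w 0 = 0\<close>, so \<open>w x = 0\<close> would give
  \<open>x = w (w x) = 0\<close>.\<close>

lemma invs_nonzero:
  assumes "w \<in> invs N" "x \<noteq> 0" shows "w x \<noteq> 0"
  using assms invs_odd[of w N 0] invs_invol[of w N x] by auto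

lemma id_in_invs: "id \<in> invs N"
  by (simp add: invs_iff)

lemma neg_apply: "neg n x = (if x = n \<or> x = - n then - x else x)"
  by (auto simp: neg_def transpose_def)

lemma cyc_apply:
  assumes "0 < i" "0 < j"
  shows "cyc i j x = (if x = i then j else if x = j then i else if x = - i then - j
    else if x = - j then - i else x)"
  using assms by (auto simp: cyc_def transpose_def)

lemma cyc_bar_apply:
  assumes "0 < i" "0 < j" "i \<noteq> j"
  shows "cyc_bar i j x = (if x = i then - j else if x = j then - i else if x = - i then j
    else if x = - j then i else x)"
  using assms by (auto simp: cyc_bar_def transpose_def)

lemma neg_count_cyc:
  assumes w: "w \<in> invs N" and ij: "0 < i" "0 < j" "i \<noteq> j" "i \<notin> signed_alphabet N" "j \<notin> signed_alphabet N"
  shows "neg_count (w \<circ> cyc i j) = neg_count w"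
proof -
  have "w i = i" "w j = j" "w (-i) = - i" "w (- j) = - j"
    using w ij by (auto simp: invs_iff)
  then have "{x. 0 < x \<and> (w \<circ> cyc i j) x < 0} = {x. 0 < x \<and> w x < 0}"
    using ij by (auto simp: cyc_apply split: if_splits)
  then show ?thesis by (simp add: neg_count_def)
qed

lemma finite_negs:
  assumes "w \<in> invs N" "finite N"
  shows "finite {x. 0 < x \<and> w x < 0}"
proof (rule finite_subset)
  show "{x. 0 < x \<and> w x < 0} \<subseteq> signed_alphabet N"
    using invs_fix[OF assms(1)] by fastforce
  show "finite (signed_alphabet N)" using assms by (simp add: signed_alphabet_def)
qed

text \<open>Being disjoint from the pair, \<open>w\<close> fixes both letters, so exactly the
  positions \<open>i\<close> and \<open>j\<close> join the set of negative positions.\<close>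

lemma neg_count_cyc_bar:
  assumes w: "w \<in> invs N" "finite N"
    and ij: "0 < i" "0 < j" "i \<noteq> j" "i \<notin> signed_alphabet N" "j \<notin> signed_alphabet N"
  shows "neg_count (w \<circ> cyc_bar i j) = neg_count w + 2"
proof -
  have fx: "w i = i" "w j = j" "w (-i) = - i" "w (- j) = - j"
    using w ij by (auto simp: invs_iff)
  then have "{x. 0 < x \<and> (w \<circ> cyc_bar i j) x < 0} = insert i (insert j {x. 0 < x \<and> w x < 0})"
    using ij by (auto simp: cyc_bar_apply split: if_splits)
  then show ?thesis using fx ij finite_negs[OF w] by (simp add: neg_count_def)
qed

lemma neg_count_neg:
  assumes w: "w \<in> invs N" "finite N" and n: "0 < n" "n \<notin> signed_alphabet N"
  shows "neg_count (w \<circ> neg n) = Suc (neg_count w)"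
proof -
  have fx: "w n = n" "w (-n) = - n"
    using w n by (auto simp: invs_iff)
  then have "{x. 0 < x \<and> (w \<circ> neg n) x < 0} = insert n {x. 0 < x \<and> w x < 0}"
    using n by (auto simp: neg_apply split: if_splits)
  then show ?thesis using fx n finite_negs[OF w] by (simp add: neg_count_def)
qed

section \<open>Relabelling\<close>

text \<open>Distinct letters make the word a bijection from \<open>[r]\<close> onto its letters.
  Positivity keeps the odd extension injective, as no letter is the negative of another.\<close>

locale relabelling =
  fixes F :: "int list"
  assumes distinct: "distinct F" and positive: "\<And>x. x \<in> set F \<Longrightarrow> 0 < x"
begin

abbreviation "dom_alph \<equiv> signed_alphabet {1..int (length F)}"
abbreviation "cod_alph \<equiv> signed_alphabet (set F)"

lemma word_map_pos:
  assumes "1 \<le> x" "x \<le> int (length F)" shows "word_map F x \<in> set F" "0 < word_map F x"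
proof -
  show "word_map F x \<in> set F" using assms by (auto simp: word_map_def)
  then show "0 < word_map F x" by (rule positive)
qed

lemma word_map_uminus: "x \<noteq> 0 \<Longrightarrow> word_map F (- x) = - word_map F x"
  by (auto simp: word_map_def)

lemma dom_alph_iff: "x \<in> dom_alph \<longleftrightarrow> 1 \<le> \<bar>x\<bar> \<and> \<bar>x\<bar> \<le> int (length F)"
  by (auto simp: signed_alphabet_altdef)

lemma word_map_pos_iff: "x \<in> dom_alph \<Longrightarrow> 0 < word_map F x \<longleftrightarrow> 0 < x"
  using word_map_pos[of x] word_map_pos[of "- x"] word_map_uminus[of x]
  by (auto simp: signed_alphabet_altdef)

lemma word_map_neg_iff: "x \<in> dom_alph \<Longrightarrow> word_map F x < 0 \<longleftrightarrow> x < 0"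
  using word_map_pos_iff[of "- x"] word_map_uminus[of x] by (auto simp: dom_alph_iff)

lemma bij_word_map_pos: "bij_betw (word_map F) {1..int (length F)} (set F)"
proof (rule bij_betw_imageI)
  show "inj_on (word_map F) {1..int (length F)}"
    using distinct by (auto simp: inj_on_def word_map_def nth_eq_iff_index_eq)
  show "word_map F ` {1..int (length F)} = set F"
  proof (intro equalityI subsetI)
    fix y assume "y \<in> set F"
    then obtain k where "k < length F" "F ! k = y" by (auto simp: in_set_conv_nth)
    then show "y \<in> word_map F ` {1..int (length F)}"
      by (intro image_eqI[of _ _ "int k + 1"]) (auto simp: word_map_def)
  qed (auto intro: word_map_pos)
qed

text \<open>\<open>word_map F\<close> preserves signs, so two arguments with the same image lie in
  the same half of the domain, and by oddness the negative half reduces to the positive one.\<close>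

lemma bij_word_map: "bij_betw (word_map F) dom_alph cod_alph"
proof (rule bij_betw_imageI)
  have I: "inj_on (word_map F) {1..int (length F)}"
    and im: "word_map F ` {1..int (length F)} = set F"
    using bij_word_map_pos by (auto simp: bij_betw_def)
  show "inj_on (word_map F) dom_alph"
  proof (rule inj_onI)
    fix x y assume xy: "x \<in> dom_alph" "y \<in> dom_alph" "word_map F x = word_map F y"
    then have "0 < x \<longleftrightarrow> 0 < y" using word_map_pos_iff by metis
    moreover have "word_map F (- x) = word_map F (- y)"
      using xy word_map_uminus[of x] word_map_uminus[of y] by (auto simp: dom_alph_iff)
    ultimately show "x = y"
      using xy inj_onD[OF I, of x y] inj_onD[OF I, of "- x" "- y"] by (auto simp: dom_alph_iff)
  qed
  have "word_map F ` uminus ` {1..int (length F)} = uminus ` word_map F ` {1..int (length F)}"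
    unfolding image_image by (rule image_cong) (auto simp: word_map_uminus)
  then show "word_map F ` dom_alph = cod_alph"
    by (simp add: signed_alphabet_def image_Un im)
qed

abbreviation "word_inv \<equiv> inv_into dom_alph (word_map F)"

lemma word_inv:
  shows "x \<in> cod_alph \<Longrightarrow> word_inv x \<in> dom_alph"
    and "x \<in> cod_alph \<Longrightarrow> word_map F (word_inv x) = x"
    and "y \<in> dom_alph \<Longrightarrow> word_inv (word_map F y) = y"
    and "y \<in> dom_alph \<Longrightarrow> word_map F y \<in> cod_alph"
  using bij_word_map bij_betw_inv_into[OF bij_word_map]
  by (auto dest: bij_betw_apply intro: bij_betw_inv_into_right bij_betw_inv_into_left)

lemma word_inv_uminus:
  assumes "x \<in> cod_alph" shows "word_inv (- x) = - word_inv x"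
proof -
  have "word_inv x \<noteq> 0" using word_inv(1)[OF assms] by (auto simp: dom_alph_iff)
  then have "word_map F (- word_inv x) = - x" by (simp add: word_map_uminus word_inv assms)
  then show ?thesis using word_inv(3)[of "- word_inv x"] word_inv(1)[OF assms] by simp
qed

lemma relabel_word_map: "y \<in> dom_alph \<Longrightarrow> relabel F w (word_map F y) = word_map F (w y)"
  by (simp add: relabel_def word_inv)

lemma relabel_outside: "x \<notin> cod_alph \<Longrightarrow> relabel F w x = x"
  by (simp add: relabel_def)

lemma relabel_in_invs:
  assumes w: "w \<in> invs {1..int (length F)}"
  shows "relabel F w \<in> invs (set F)"
  unfolding invs_iff
proof (intro conjI allI impI)
  fix x
  show "relabel F w (relabel F w x) = x"
    using w by (cases "x \<in> cod_alph") (auto simp: relabel_def word_inv invs_in invs_invol)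
  show "relabel F w (- x) = - relabel F w x"
  proof (cases "x \<in> cod_alph")
    case True
    have "w (word_inv x) \<in> dom_alph" using True w by (simp add: invs_in word_inv)
    then have "w (word_inv x) \<noteq> 0" by (auto simp: dom_alph_iff)
    then show ?thesis
      using True by (simp add: relabel_def word_inv_uminus invs_odd[OF w] word_map_uminus)
  qed (simp add: relabel_outside)
qed (rule relabel_outside)

lemma relabel_inj: "inj_on (relabel F) (invs {1..int (length F)})"
proof (rule inj_onI, rule ext)
  fix u v x assume u: "u \<in> invs {1..int (length F)}" and v: "v \<in> invs {1..int (length F)}"
    and eq: "relabel F u = relabel F v"
  show "u x = v x"
  proof (cases "x \<in> dom_alph")
    case True
    then have "word_map F (u x) = word_map F (v x)" by (metis eq relabel_word_map)
    then show ?thesis using True u v invs_in word_inv(3) by metis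
  qed (use u v invs_fix in metis)
qed

lemma relabel_surj:
  assumes w: "w \<in> invs (set F)"
  obtains u where "u \<in> invs {1..int (length F)}" "relabel F u = w"
proof
  \<comment> \<open>The preimage is \<open>w\<close> conjugated back along
    \<open>word_map F\<close>.\<close>
  define u where "u y = (if y \<in> dom_alph then word_inv (w (word_map F y)) else y)" for y
  show "u \<in> invs {1..int (length F)}"
    unfolding invs_iff
  proof (intro conjI allI impI)
    fix y
    show "u (u y) = y"
      using w by (cases "y \<in> dom_alph") (auto simp: u_def word_inv invs_in invs_invol)
    show "u (- y) = - u y"
    proof (cases "y \<in> dom_alph")
      case True
      then have "y \<noteq> 0" by (auto simp: dom_alph_iff)
      then show ?thesis
        using True w by (simp add: u_def word_map_uminus invs_odd word_inv_uminus invs_in word_inv)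
    qed (simp add: u_def)
  qed (simp add: u_def)
  show "relabel F u = w"
  proof
    fix x show "relabel F u x = w x"
      using w by (cases "x \<in> cod_alph") (auto simp: relabel_def u_def word_inv invs_in invs_fix)
  qed
qed

lemma relabel_image: "relabel F ` invs {1..int (length F)} = invs (set F)"
  using relabel_in_invs relabel_surj by (auto simp: image_iff) metis

text \<open>Since \<open>word_map F\<close> preserves the signs of both positions and entries, it
  carries the negative positions of \<open>w\<close> bijectively to those of the relabelled
  involution.\<close>

lemma neg_count_relabel:
  assumes w: "w \<in> invs {1..int (length F)}"
  shows "neg_count (relabel F w) = neg_count w"
proof -
  let ?A = "{y. 0 < y \<and> w y < 0}"
  have A: "?A \<subseteq> dom_alph" using invs_fix[OF w] by fastforce
  have "{x. 0 < x \<and> relabel F w x < 0} = word_map F ` ?A"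
  proof (intro equalityI subsetI)
    fix x assume x: "x \<in> {x. 0 < x \<and> relabel F w x < 0}"
    then have c: "x \<in> cod_alph" using relabel_outside[of x w] by fastforce
    then have "0 < word_inv x" "w (word_inv x) < 0"
      using x word_map_pos_iff[of "word_inv x"] word_map_neg_iff[of "w (word_inv x)"] w
      by (auto simp: word_inv invs_in relabel_def)
    then show "x \<in> word_map F ` ?A" using c by (intro image_eqI[of _ _ "word_inv x"]) (auto simp: word_inv)
  next
    fix x assume "x \<in> word_map F ` ?A"
    then obtain y where y: "x = word_map F y" "0 < y" "w y < 0" "y \<in> dom_alph" using A by auto
    then show "x \<in> {x. 0 < x \<and> relabel F w x < 0}"
      using w by (simp add: relabel_word_map word_map_pos_iff word_map_neg_iff invs_in)
  qed
  moreover have "inj_on (word_map F) ?A"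
    using bij_word_map A by (auto simp: bij_betw_def intro: inj_on_subset)
  ultimately show ?thesis by (simp add: neg_count_def card_image)
qed

lemma relabel_id: "relabel F id = id"
  by (rule ext) (simp add: relabel_def word_inv)

text \<open>Conjugating a cycle replaces its letters by their images. This locates the last element
  of a relabelled list.\<close>

lemma relabel_cyc:
  assumes "p \<in> {1..int (length F)}" "q \<in> {1..int (length F)}" "p \<noteq> q"
  shows "relabel F (cyc p q) = cyc (word_map F p) (word_map F q)"
    and "relabel F (cyc_bar p q) = cyc_bar (word_map F p) (word_map F q)"
proof -
  have d: "p \<in> dom_alph" "q \<in> dom_alph" "0 < p" "0 < q"
    using assms by (auto simp: signed_alphabet_def)
  have pos: "0 < word_map F p" "0 < word_map F q"
    using assms word_map_pos by auto
  have inj: "word_map F y = word_map F z \<longleftrightarrow> y = z" if "y \<in> dom_alph" "z \<in> dom_alph" for y z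
    using that word_inv(3) by metis
  \<comment> \<open>With negated images written as images, every comparison of letters pulls back
    through \<open>inj\<close>.\<close>
  have um: "- word_map F p = word_map F (- p)" "- word_map F q = word_map F (- q)"
    using d by (auto simp: word_map_uminus)
  have ne: "word_map F p \<noteq> word_map F q" using inj d assms by simp
  show "relabel F (cyc p q) = cyc (word_map F p) (word_map F q)"
  proof
    fix x show "relabel F (cyc p q) x = cyc (word_map F p) (word_map F q) x"
    proof (cases "x \<in> cod_alph")
      case True
      then obtain y where y: "y \<in> dom_alph" "x = word_map F y" by (metis word_inv(1,2))
      show ?thesis unfolding y(2) relabel_word_map[OF y(1)] cyc_apply[OF pos] cyc_apply[OF d(3,4)]
        by (simp add: um inj d y)
    next
      case False
      then have "x \<noteq> word_map F y" if "y \<in> dom_alph" for y using that word_inv(4) by blast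
      then show ?thesis using False d by (simp add: relabel_outside cyc_apply pos um)
    qed
  qed
  show "relabel F (cyc_bar p q) = cyc_bar (word_map F p) (word_map F q)"
  proof
    fix x show "relabel F (cyc_bar p q) x = cyc_bar (word_map F p) (word_map F q) x"
    proof (cases "x \<in> cod_alph")
      case True
      then obtain y where y: "y \<in> dom_alph" "x = word_map F y" by (metis word_inv(1,2))
      show ?thesis
        unfolding y(2) relabel_word_map[OF y(1)] cyc_bar_apply[OF pos ne] cyc_bar_apply[OF d(3,4) assms(3)]
        by (simp add: um inj d y)
    next
      case False
      then have "x \<noteq> word_map F y" if "y \<in> dom_alph" for y using that word_inv(4) by blast
      then show ?thesis using False d ne by (simp add: relabel_outside cyc_bar_apply pos um)
    qed
  qed
qed

end

section \<open>The steps of A2 on functions\<close>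

text \<open>The composite of two transpositions sends \<open>p\<close> to \<open>q\<close>,
  \<open>q\<close> to \<open>r\<close> and \<open>r\<close> to \<open>p\<close>, so precomposing
  with it is what \<open>rotate3 p q r\<close> does. The identity stands for pure sign
  changes.\<close>

definition short_cycle :: "'a set \<Rightarrow> ('a \<Rightarrow> 'a) \<Rightarrow> bool" where
  "short_cycle N \<tau> \<longleftrightarrow> \<tau> = id \<or> (\<exists>p\<in>N. \<exists>q\<in>N. p \<noteq> q \<and> \<tau> = transpose p q) \<or>
    (\<exists>p\<in>N. \<exists>q\<in>N. \<exists>r\<in>N. distinct [p, q, r] \<and> \<tau> = transpose p q \<circ> transpose q r)"

text \<open>\<open>S\<close> consists of positions in the new word, after the entries have moved.
  Only positions in \<open>N\<close> are compared, and \<open>S\<close> must be nonempty for the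
  identity so that a step is never void.\<close>

definition signed_step :: "int set \<Rightarrow> (int \<Rightarrow> int) \<Rightarrow> int set \<Rightarrow> (int \<Rightarrow> int) \<Rightarrow> (int \<Rightarrow> int) \<Rightarrow> bool" where
  "signed_step N \<tau> S u v \<longleftrightarrow> short_cycle N \<tau> \<and> S \<subseteq> N \<and> finite S \<and> card S \<le> 2 \<and> (\<tau> = id \<longrightarrow> S \<noteq> {}) \<and>
    (\<forall>x\<in>N. v x = (if x \<in> S then - u (\<tau> x) else u (\<tau> x)))"

definition a2 :: "int set \<Rightarrow> (int \<Rightarrow> int) \<Rightarrow> (int \<Rightarrow> int) \<Rightarrow> bool" where
  "a2 N u v \<longleftrightarrow> (\<exists>\<tau> S. signed_step N \<tau> S u v)"

lemma short_cycle_permutes: "short_cycle N \<tau> \<Longrightarrow> \<tau> permutes N"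
  unfolding short_cycle_def
  by (elim disjE bexE conjE) (auto intro: permutes_id permutes_compose permutes_swap_id)

lemma short_cycle_mono: "short_cycle N \<tau> \<Longrightarrow> N \<subseteq> M \<Longrightarrow> short_cycle M \<tau>"
  unfolding short_cycle_def by blast

lemma short_cycle_inv:
  assumes "short_cycle N \<tau>"
  obtains \<sigma> where "short_cycle N \<sigma>" "\<sigma> \<circ> \<tau> = id" "\<tau> \<circ> \<sigma> = id"
proof -
  have "\<exists>\<sigma>. short_cycle N \<sigma> \<and> \<sigma> \<circ> \<tau> = id \<and> \<tau> \<circ> \<sigma> = id"
    using assms unfolding short_cycle_def
  proof (elim disjE bexE conjE)
    fix p q r assume *: "p \<in> N" "q \<in> N" "r \<in> N" "distinct [p, q, r]" "\<tau> = transpose p q \<circ> transpose q r"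
    show "\<exists>\<sigma>. (\<sigma> = id \<or> (\<exists>p\<in>N. \<exists>q\<in>N. p \<noteq> q \<and> \<sigma> = transpose p q) \<or>
      (\<exists>p\<in>N. \<exists>q\<in>N. \<exists>r\<in>N. distinct [p, q, r] \<and> \<sigma> = transpose p q \<circ> transpose q r)) \<and> \<sigma> \<circ> \<tau> = id \<and> \<tau> \<circ> \<sigma> = id"
    \<comment> \<open>The inverse is the product in reverse order, which is again of the required
      form, for the triple \<open>r\<close>, \<open>q\<close>, \<open>p\<close>.\<close>
    proof (intro exI[of _ "transpose r q \<circ> transpose q p"] conjI disjI2)
      show "\<exists>a\<in>N. \<exists>b\<in>N. \<exists>c\<in>N. distinct [a, b, c] \<and> transpose r q \<circ> transpose q p = transpose a b \<circ> transpose b c"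
        using * by (intro bexI[of _ r] bexI[of _ q] bexI[of _ p]) auto
    qed (auto simp: *(5) fun_eq_iff transpose_def)
  next
    fix p q assume "p \<in> N" "q \<in> N" "p \<noteq> q" "\<tau> = transpose p q"
    then show "\<exists>\<sigma>. (\<sigma> = id \<or> (\<exists>p\<in>N. \<exists>q\<in>N. p \<noteq> q \<and> \<sigma> = transpose p q) \<or>
      (\<exists>p\<in>N. \<exists>q\<in>N. \<exists>r\<in>N. distinct [p, q, r] \<and> \<sigma> = transpose p q \<circ> transpose q r)) \<and> \<sigma> \<circ> \<tau> = id \<and> \<tau> \<circ> \<sigma> = id"
      by (intro exI[of _ "transpose p q"]) auto
  qed auto
  then show ?thesis using that by blast
qed

text \<open>The inverse permutation moves the entries back, and the sign changed at position
  \<open>x\<close> of \<open>v\<close> has to be changed at position \<open>\<tau> x\<close> of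
  \<open>u\<close>. This is what makes reversed lists usable.\<close>

lemma a2_sym:
  assumes "a2 N u v" shows "a2 N v u"
proof -
  from assms obtain \<tau> S where *: "signed_step N \<tau> S u v" by (auto simp: a2_def)
  then have sc: "short_cycle N \<tau>" by (simp add: signed_step_def)
  from sc obtain \<sigma> where \<sigma>: "short_cycle N \<sigma>" "\<sigma> \<circ> \<tau> = id" "\<tau> \<circ> \<sigma> = id"
    by (rule short_cycle_inv)
  note perm = short_cycle_permutes[OF sc] short_cycle_permutes[OF \<sigma>(1)]
  have \<tau>\<sigma>: "\<tau> (\<sigma> x) = x" "\<sigma> (\<tau> x) = x" for x using \<sigma>(2,3) by (auto simp: fun_eq_iff)
  have "signed_step N \<sigma> (\<tau> ` S) v u"
    unfolding signed_step_def
  proof (intro conjI ballI impI)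
    show "\<tau> ` S \<subseteq> N" using * perm by (auto simp: signed_step_def permutes_in_image)
    show "finite (\<tau> ` S)" using * by (simp add: signed_step_def)
    show "card (\<tau> ` S) \<le> 2" using * card_image_le[of S \<tau>] by (simp add: signed_step_def)
    show "\<tau> ` S \<noteq> {}" if "\<sigma> = id" using * \<sigma> that by (simp add: signed_step_def)
    fix x assume "x \<in> N"
    then have "\<sigma> x \<in> N" using perm by (simp add: permutes_in_image)
    then have "v (\<sigma> x) = (if \<sigma> x \<in> S then - u x else u x)" using * by (simp add: signed_step_def \<tau>\<sigma>)
    moreover have "\<sigma> x \<in> S \<longleftrightarrow> x \<in> \<tau> ` S" by (metis \<tau>\<sigma> image_iff)
    ultimately show "u x = (if x \<in> \<tau> ` S then - v (\<sigma> x) else v (\<sigma> x))" by auto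
  qed fact
  then show ?thesis by (auto simp: a2_def)
qed

text \<open>Letters outside \<open>N\<close> are fixed by \<tau> and avoided by \<open>S\<close>, so
  the same \<tau> and \<open>S\<close> work over \<open>M\<close> once the two functions agree on
  the added letters.\<close>

lemma a2_mono:
  assumes "a2 N u v" "N \<subseteq> M" "\<And>x. x \<in> N \<Longrightarrow> u' x = u x" "\<And>x. x \<in> N \<Longrightarrow> v' x = v x"
    "\<And>x. x \<in> M - N \<Longrightarrow> u' x = v' x"
  shows "a2 M u' v'"
proof -
  from assms(1) obtain \<tau> S where *: "signed_step N \<tau> S u v" by (auto simp: a2_def)
  then have perm: "\<tau> permutes N" by (simp add: signed_step_def short_cycle_permutes)
  have "v' x = (if x \<in> S then - u' (\<tau> x) else u' (\<tau> x))" if "x \<in> M" for x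
  proof (cases "x \<in> N")
    case True
    then show ?thesis using * perm assms(3,4) by (simp add: signed_step_def permutes_in_image)
  next
    case False
    then have "x \<notin> S" "\<tau> x = x" using * perm by (auto simp: signed_step_def permutes_not_in)
    then show ?thesis using False that assms(5) by simp
  qed
  then have "signed_step M \<tau> S u' v'"
    using * assms(2) short_cycle_mono[of N \<tau> M] by (auto simp: signed_step_def)
  then show ?thesis by (auto simp: a2_def)
qed

lemma a2_swap:
  assumes "p \<in> N" "q \<in> N" "p \<noteq> q" "S \<subseteq> N" "finite S" "card S \<le> 2"
    and "\<And>x. x \<in> N \<Longrightarrow> v x = (if x \<in> S then - u (transpose p q x) else u (transpose p q x))"
  shows "a2 N u v"
proof -
  have "transpose p q \<noteq> id" using assms(3) by (metis id_apply transpose_apply_first)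
  moreover have "short_cycle N (transpose p q)" using assms by (auto simp: short_cycle_def)
  ultimately show ?thesis using assms unfolding a2_def signed_step_def by blast
qed

lemma a2_rotate:
  assumes "p \<in> N" "q \<in> N" "r \<in> N" "distinct [p, q, r]" "S \<subseteq> N" "finite S" "card S \<le> 2"
    and "\<And>x. x \<in> N \<Longrightarrow> v x = (if x \<in> S then - u ((transpose p q \<circ> transpose q r) x)
      else u ((transpose p q \<circ> transpose q r) x))"
  shows "a2 N u v"
proof -
  have "(transpose p q \<circ> transpose q r) q \<noteq> q" using assms(4) by (auto simp: transpose_def)
  then have "transpose p q \<circ> transpose q r \<noteq> id" by fastforce
  moreover have "short_cycle N (transpose p q \<circ> transpose q r)" using assms(1-4) unfolding short_cycle_def by blast
  ultimately show ?thesis using assms unfolding a2_def signed_step_def by blast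
qed

lemma a2_signs:
  assumes "S \<subseteq> N" "finite S" "card S \<le> 2" "S \<noteq> {}"
    and "\<And>x. x \<in> N \<Longrightarrow> v x = (if x \<in> S then - u x else u x)"
  shows "a2 N u v"
proof -
  have "short_cycle N id" by (simp add: short_cycle_def)
  with assms have "signed_step N id S u v" unfolding signed_step_def by simp
  then show ?thesis unfolding a2_def by blast
qed

text \<open>As \<open>f\<close> is injective only on \<open>N\<close>, \<sigma> is built from the
  images of the letters of the cycle instead of by conjugation. The last clause transports the
  requirement that a step with trivial permutation changes some sign.\<close>

lemma short_cycle_image:
  assumes inj: "inj_on f N" and sc: "short_cycle N \<tau>"
  obtains \<sigma> where "short_cycle (f ` N) \<sigma>" "\<And>x. x \<in> N \<Longrightarrow> \<sigma> (f x) = f (\<tau> x)" "\<sigma> = id \<Longrightarrow> \<tau> = id"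
proof -
  have eq: "f x = f y \<longleftrightarrow> x = y" if "x \<in> N" "y \<in> N" for x y
    using inj that by (auto simp: inj_on_def)
  have "\<exists>\<sigma>. short_cycle (f ` N) \<sigma> \<and> (\<forall>x\<in>N. \<sigma> (f x) = f (\<tau> x))"
    using sc unfolding short_cycle_def[of N]
  proof (elim disjE bexE conjE)
    assume "\<tau> = id"
    then show ?thesis by (intro exI[of _ id]) (auto simp: short_cycle_def)
  next
    fix p q assume *: "p \<in> N" "q \<in> N" "p \<noteq> q" "\<tau> = transpose p q"
    then have "short_cycle (f ` N) (transpose (f p) (f q))" unfolding short_cycle_def using eq by blast
    moreover have "\<forall>x\<in>N. transpose (f p) (f q) (f x) = f (\<tau> x)"
      using * eq by (auto simp: transpose_def)
    ultimately show ?thesis by blast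
  next
    fix p q r assume *: "p \<in> N" "q \<in> N" "r \<in> N" "distinct [p, q, r]" "\<tau> = transpose p q \<circ> transpose q r"
    then have "distinct [f p, f q, f r]" using eq by auto
    then have "short_cycle (f ` N) (transpose (f p) (f q) \<circ> transpose (f q) (f r))"
      unfolding short_cycle_def using * by blast
    moreover have "\<forall>x\<in>N. (transpose (f p) (f q) \<circ> transpose (f q) (f r)) (f x) = f (\<tau> x)"
      using * eq by (auto simp: transpose_def)
    ultimately show ?thesis by blast
  qed
  then obtain \<sigma> where \<sigma>: "short_cycle (f ` N) \<sigma>" "\<And>x. x \<in> N \<Longrightarrow> \<sigma> (f x) = f (\<tau> x)" by blast
  have perm: "\<tau> permutes N" using sc by (rule short_cycle_permutes)
  have "\<tau> = id" if "\<sigma> = id"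
  proof
    fix x show "\<tau> x = id x"
    proof (cases "x \<in> N")
      case True
      then show ?thesis using \<sigma>(2)[OF True] that eq perm by (simp add: permutes_in_image)
    next
      case False
      then show ?thesis using perm by (simp add: permutes_not_in)
    qed
  qed
  with \<sigma> show ?thesis by (rule that)
qed

section \<open>Steps between one-line words and steps between functions\<close>

text \<open>Exchanges and rotations are both reindexings of the word along a permutation of
  positions, so the three clauses of A2 match the three kinds of short cycle.\<close>

lemma A2_step_iff_short_cycle:
  "A2_step xs ys \<longleftrightarrow> (\<exists>\<tau> S. short_cycle {..<length xs} \<tau> \<and> S \<subseteq> {..<length xs} \<and> card S \<le> 2 \<and>
    (\<tau> = id \<longrightarrow> S \<noteq> {}) \<and> ys = change_signs S (map (\<lambda>k. xs ! \<tau> k) [0..<length xs]))"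
  (is "?L \<longleftrightarrow> ?R")
proof -
  let ?m = "\<lambda>\<tau>. map (\<lambda>k. xs ! \<tau> k) [0..<length xs]"
  let ?N = "{..<length xs}"
  have ex: "exchange p q xs = ?m (transpose p q)" if "p < length xs" "q < length xs" for p q
    using that by (intro nth_equalityI) (auto simp: exchange_def transpose_def nth_list_update)
  have rot: "rotate3 p q r xs = ?m (transpose p q \<circ> transpose q r)"
    if "p < length xs" "q < length xs" "r < length xs" "distinct [p, q, r]" for p q r
    using that by (intro nth_equalityI) (auto simp: rotate3_def transpose_def nth_list_update)
  have idm: "?m id = xs" by (simp add: map_nth)
  have id1: "transpose p q \<noteq> id" if "p \<noteq> q" for p q :: nat
    using that by (metis id_apply transpose_apply_first)
  have id2: "transpose p q \<circ> transpose q r \<noteq> id" if "distinct [p, q, r]" for p q r :: nat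
  proof -
    have "(transpose p q \<circ> transpose q r) q \<noteq> id q" using that by (auto simp: transpose_def)
    then show ?thesis by metis
  qed
  \<comment> \<open>Finiteness of \<open>S\<close> matters here, because \<open>card\<close> is 0 on
    infinite sets as well.\<close>
  have card: "card S \<in> {1, 2} \<longleftrightarrow> card S \<le> 2 \<and> S \<noteq> {}" if "S \<subseteq> ?N" for S
  proof -
    have "card S = 0 \<longleftrightarrow> S = {}" using finite_subset[OF that] by simp
    then show ?thesis by force
  qed
  show ?thesis
  proof
    assume ?L
    then show ?R unfolding A2_step_def
    proof (elim disjE exE conjE bexE)
      fix p q S assume *: "p < length xs" "q < length xs" "S \<subseteq> ?N" "p \<noteq> q" "card S \<le> 2"
        "ys = change_signs S (exchange p q xs)"
      then have "short_cycle ?N (transpose p q)" unfolding short_cycle_def by blast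
      then show ?R using * ex id1 by metis
    next
      fix p q r S assume *: "p < length xs" "q < length xs" "r < length xs" "S \<subseteq> ?N"
        "distinct [p, q, r]" "card S \<le> 2" "ys = change_signs S (rotate3 p q r xs)"
      then have "short_cycle ?N (transpose p q \<circ> transpose q r)" unfolding short_cycle_def by blast
      then show ?R using * rot id2 by metis
    next
      fix S assume *: "S \<subseteq> ?N" "card S \<in> {1, 2}" "ys = change_signs S xs"
      have "short_cycle ?N id" by (simp add: short_cycle_def)
      moreover have "card S \<le> 2" "S \<noteq> {}" using * card by blast+
      ultimately show ?R using * idm by metis
    qed
  next
    assume ?R
    then obtain \<tau> S where *: "short_cycle ?N \<tau>" "S \<subseteq> ?N" "card S \<le> 2" "\<tau> = id \<longrightarrow> S \<noteq> {}"
      "ys = change_signs S (?m \<tau>)" by blast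
    from *(1) show ?L unfolding short_cycle_def
    proof (elim disjE bexE conjE)
      assume "\<tau> = id"
      then show ?L using * idm card[of S] unfolding A2_step_def by metis
    next
      fix p q assume **: "p \<in> ?N" "q \<in> ?N" "p \<noteq> q" "\<tau> = transpose p q"
      then have "ys = change_signs S (exchange p q xs)" using * ex by simp
      then show ?L using * ** unfolding A2_step_def by blast
    next
      fix p q r assume **: "p \<in> ?N" "q \<in> ?N" "r \<in> ?N" "distinct [p, q, r]" "\<tau> = transpose p q \<circ> transpose q r"
      then have "ys = change_signs S (rotate3 p q r xs)" using * rot by simp
      then show ?L using * ** unfolding A2_step_def by blast
    qed
  qed
qed

lemma one_line_eq_change_signs:
  assumes "length xs = n"
  shows "one_line n v = change_signs S xs \<longleftrightarrow> (\<forall>k<n. v (int k + 1) = (if k \<in> S then - xs ! k else xs ! k))"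
  using assms by (auto simp: list_eq_iff_nth_eq one_line_def change_signs_def add.commute)

lemma A2_step_one_line: "A2_step (one_line n u) (one_line n v) \<longleftrightarrow> a2 {1..int n} u v" (is "?L \<longleftrightarrow> ?R")
proof -
  \<comment> \<open>List positions start at 0 and letters at 1; these two shifts are inverse to each
    other on the relevant ranges.\<close>
  let ?f = "\<lambda>k. int k + 1" and ?g = "\<lambda>x. nat (x - 1)"
  have im: "?f ` {..<n} = {1..int n}" "?g ` {1..int n} = {..<n}"
    by (force simp: image_iff Bex_def intro: exI[of _ "nat (_ - 1)"] exI[of _ "int _ + 1"])+
  have inj: "inj_on ?f A" "inj_on ?g {1..int n}" for A
    by (auto simp: inj_on_def)
  have len: "length (one_line n u) = n" by (simp add: one_line_def)
  have nth: "one_line n u ! k = u (?f k)" if "k < n" for k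
    using that by (simp add: one_line_def add.commute)
  have eq: "one_line n v = change_signs S (map (\<lambda>k. one_line n u ! \<tau> k) [0..<n]) \<longleftrightarrow>
      (\<forall>k<n. v (?f k) = (if k \<in> S then - u (?f (\<tau> k)) else u (?f (\<tau> k))))"
    if "short_cycle {..<n} \<tau>" for \<tau> S
  proof -
    have "\<tau> k < n" if "k < n" for k
      using short_cycle_permutes[OF \<open>short_cycle {..<n} \<tau>\<close>] that permutes_in_image by fastforce
    then show ?thesis by (subst one_line_eq_change_signs) (auto simp: nth)
  qed
  show ?thesis
  proof
    assume ?L
    then obtain \<tau> S where *: "short_cycle {..<n} \<tau>" "S \<subseteq> {..<n}" "card S \<le> 2" "\<tau> = id \<longrightarrow> S \<noteq> {}"
      "\<And>k. k < n \<Longrightarrow> v (?f k) = (if k \<in> S then - u (?f (\<tau> k)) else u (?f (\<tau> k)))"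
      unfolding A2_step_iff_short_cycle len using eq by blast
    obtain \<sigma> where \<sigma>: "short_cycle {1..int n} \<sigma>" "\<And>k. k \<in> {..<n} \<Longrightarrow> \<sigma> (?f k) = ?f (\<tau> k)" "\<sigma> = id \<Longrightarrow> \<tau> = id"
      using short_cycle_image[OF inj(1) *(1)] unfolding im by metis
    have "signed_step {1..int n} \<sigma> (?f ` S) u v" unfolding signed_step_def
    proof (intro conjI ballI impI)
      show "?f ` S \<subseteq> {1..int n}" using *(2) by auto
      show "finite (?f ` S)" using *(2) finite_subset by blast
      show "card (?f ` S) \<le> 2" using *(3) by (simp add: card_image inj)
      show "?f ` S \<noteq> {}" if "\<sigma> = id" using \<sigma> * that by auto
      fix x assume "x \<in> {1..int n}"
      then obtain k where k: "x = ?f k" "k < n" using im by blast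
      then show "v x = (if x \<in> ?f ` S then - u (\<sigma> x) else u (\<sigma> x))" using * \<sigma>(2) by auto
    qed (rule \<sigma>)
    then show ?R unfolding a2_def by blast
  next
    assume ?R
    then obtain \<tau> S where *: "short_cycle {1..int n} \<tau>" "S \<subseteq> {1..int n}" "finite S" "card S \<le> 2"
      "\<tau> = id \<longrightarrow> S \<noteq> {}" "\<And>x. x \<in> {1..int n} \<Longrightarrow> v x = (if x \<in> S then - u (\<tau> x) else u (\<tau> x))"
      unfolding a2_def signed_step_def by blast
    obtain \<sigma> where \<sigma>: "short_cycle {..<n} \<sigma>" "\<And>x. x \<in> {1..int n} \<Longrightarrow> \<sigma> (?g x) = ?g (\<tau> x)" "\<sigma> = id \<Longrightarrow> \<tau> = id"
      using short_cycle_image[OF inj(2) *(1)] unfolding im by metis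
    have \<tau>n: "\<tau> x \<in> {1..int n} \<longleftrightarrow> x \<in> {1..int n}" for x
      using short_cycle_permutes[OF *(1)] by (rule permutes_in_image)
    have "\<forall>k<n. v (?f k) = (if k \<in> ?g ` S then - u (?f (\<sigma> k)) else u (?f (\<sigma> k)))"
    proof (intro allI impI)
      fix k assume k: "k < n"
      then have f: "?f k \<in> {1..int n}" by auto
      have "?f (\<sigma> k) = \<tau> (?f k)" using \<sigma>(2)[OF f] \<tau>n[of "?f k"] f by simp
      moreover have "k \<in> ?g ` S \<longleftrightarrow> ?f k \<in> S" using *(2) by (force simp: image_iff)
      ultimately show "v (?f k) = (if k \<in> ?g ` S then - u (?f (\<sigma> k)) else u (?f (\<sigma> k)))"
        using *(6)[OF f] by simp
    qed
    moreover have "?g ` S \<subseteq> {..<n}" using *(2) im by blast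
    moreover have "card (?g ` S) \<le> 2" using card_image_le[OF *(3), of ?g] *(4) by linarith
    moreover have "\<sigma> = id \<longrightarrow> ?g ` S \<noteq> {}" using \<sigma> * by blast
    ultimately show ?L unfolding A2_step_iff_short_cycle len using eq \<sigma>(1) by blast
  qed
qed

lemma property_A2_iff: "property_A2 n L \<longleftrightarrow> successively (a2 {1..int n}) L"
  by (simp add: property_A2_def A2_step_one_line)

section \<open>Steps under relabelling, and their effect on parity\<close>

text \<open>Relabelling acts on positions and on entries. On positions it transports \<tau> and
  \<open>S\<close>; on entries it commutes with sign changes because \<open>word_map F\<close> is
  odd.\<close>

lemma (in relabelling) a2_relabel:
  assumes u: "u \<in> invs {1..int (length F)}" and "a2 {1..int (length F)} u v"
  shows "a2 (set F) (relabel F u) (relabel F v)"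
proof -
  let ?N = "{1..int (length F)}"
  obtain \<tau> S where *: "short_cycle ?N \<tau>" "S \<subseteq> ?N" "finite S" "card S \<le> 2"
    "\<tau> = id \<longrightarrow> S \<noteq> {}" "\<And>x. x \<in> ?N \<Longrightarrow> v x = (if x \<in> S then - u (\<tau> x) else u (\<tau> x))"
    using assms(2) unfolding a2_def signed_step_def by blast
  have inj: "inj_on (word_map F) ?N" and im: "word_map F ` ?N = set F"
    using bij_word_map_pos by (auto simp: bij_betw_def)
  obtain \<sigma> where \<sigma>: "short_cycle (set F) \<sigma>" "\<And>x. x \<in> ?N \<Longrightarrow> \<sigma> (word_map F x) = word_map F (\<tau> x)"
      "\<sigma> = id \<Longrightarrow> \<tau> = id"
    using short_cycle_image[OF inj *(1)] unfolding im by metis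
  have "signed_step (set F) \<sigma> (word_map F ` S) (relabel F u) (relabel F v)"
    unfolding signed_step_def
  proof (intro conjI ballI impI)
    show "word_map F ` S \<subseteq> set F" using *(2) im by blast
    show "card (word_map F ` S) \<le> 2" using card_image_le[OF *(3), of "word_map F"] *(4) by linarith
    show "word_map F ` S \<noteq> {}" if "\<sigma> = id" using \<sigma> * that by auto
    fix x assume "x \<in> set F"
    then obtain y where y: "x = word_map F y" "y \<in> ?N" using im by blast
    have "\<tau> y \<in> ?N" using short_cycle_permutes[OF *(1)] y(2) by (simp only: permutes_in_image)
    then have d: "y \<in> dom_alph" "\<tau> y \<in> dom_alph" "\<tau> y \<noteq> 0" using y(2) by (auto simp: signed_alphabet_def)
    have mem: "x \<in> word_map F ` S \<longleftrightarrow> y \<in> S" using y inj *(2) by (simp add: inj_on_image_mem_iff)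
    have "relabel F v x = word_map F (v y)" by (simp add: y relabel_word_map d)
    \<comment> \<open>\<open>word_map F\<close> is known to be odd only away from 0, so the entry
      \<open>u (\<tau> y)\<close> has to be nonzero.\<close>
    also have "\<dots> = (if y \<in> S then - word_map F (u (\<tau> y)) else word_map F (u (\<tau> y)))"
      using *(6)[OF y(2)] word_map_uminus[OF invs_nonzero[OF u d(3)]] by auto
    also have "word_map F (u (\<tau> y)) = relabel F u (\<sigma> x)"
      using y by (simp add: \<sigma>(2) relabel_word_map d)
    finally show "relabel F v x = (if x \<in> word_map F ` S then - relabel F u (\<sigma> x) else relabel F u (\<sigma> x))"
      by (simp add: mem)
  qed (use * \<sigma> in auto)
  then show ?thesis unfolding a2_def by blast
qed

lemma neg_count_on:
  assumes "w \<in> invs N" "\<And>x. x \<in> N \<Longrightarrow> 0 < x"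
  shows "neg_count w = card {x \<in> N. w x < 0}"
proof -
  have "{x. 0 < x \<and> w x < 0} = {x \<in> N. w x < 0}"
    using assms(2) invs_fix[OF assms(1)] by (fastforce simp: signed_alphabet_altdef)
  then show ?thesis by (simp add: neg_count_def)
qed

text \<open>Moving entries preserves the number of negative ones. As no entry is 0, each position in
  \<open>S\<close> then changes that number by exactly one.\<close>

lemma signed_step_parity:
  assumes u: "u \<in> invs N" and v: "v \<in> invs N" and N: "finite N" "\<And>x. x \<in> N \<Longrightarrow> 0 < x"
    and step: "signed_step N \<tau> S u v"
  shows "even (neg_count v) \<longleftrightarrow> even (neg_count u + card S)"
proof -
  define A where "A = {x \<in> N. u (\<tau> x) < 0}"
  have perm: "\<tau> permutes N" and S: "finite S" "S \<subseteq> N"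
    using step short_cycle_permutes by (auto simp: signed_step_def)
  have fin: "finite A" using N by (simp add: A_def)
  have "\<tau> ` A = {x \<in> N. u x < 0}"
  proof (intro equalityI subsetI)
    fix x assume x: "x \<in> {x \<in> N. u x < 0}"
    then obtain y where "y \<in> N" "x = \<tau> y" using permutes_image[OF perm] by blast
    then show "x \<in> \<tau> ` A" using x by (auto simp: A_def)
  qed (use permutes_in_image[OF perm] in \<open>auto simp: A_def\<close>)
  then have cu: "neg_count u = card A"
    using card_image[OF inj_on_subset[OF permutes_inj[OF perm]], of A] u N by (simp add: neg_count_on)
  \<comment> \<open>A position of \<open>v\<close> is negative iff exactly one of two things holds:
    the entry moved there was negative, or its sign was changed.\<close>
  have "{x \<in> N. v x < 0} = (A - S) \<union> (S - A)"
  proof -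
    have "u (\<tau> x) \<noteq> 0" if "x \<in> N" for x
    proof -
      have "0 < \<tau> x" using that N permutes_in_image[OF perm] by blast
      then show ?thesis using invs_nonzero[OF u] by simp
    qed
    then show ?thesis using step by (fastforce simp: A_def signed_step_def)
  qed
  then have "neg_count v = card (A - S) + card (S - A)"
    using v N fin S by (simp add: neg_count_on) (subst card_Un_disjoint, auto)
  moreover have "card A = card (A \<inter> S) + card (A - S)" "card S = card (S \<inter> A) + card (S - A)"
    using fin S by (auto intro: card_Int_Diff)
  ultimately show ?thesis using cu by (auto simp: Int_commute)
qed

section \<open>Decomposing involutions\<close>

lemma signed_alphabet_disjoint:
  assumes "M \<inter> P = {}" "\<And>x. x \<in> M \<union> P \<Longrightarrow> 0 < x"
  shows "signed_alphabet M \<inter> signed_alphabet P = {}"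
proof -
  have "\<not> (x \<in> P \<and> - x \<in> M)" "\<not> (x \<in> M \<and> - x \<in> P)" "\<not> (- x \<in> P \<and> - x \<in> M)" for x
    using assms(1) assms(2)[of x] assms(2)[of "- x"] by auto
  then show ?thesis using assms(1) by (auto simp: signed_alphabet_altdef)
qed

text \<open>Each factor preserves its own signed alphabet and fixes the other one pointwise, so the
  two involutions act independently.\<close>

lemma invs_compose:
  assumes w: "w \<in> invs M" and t: "t \<in> invs P" and disj: "signed_alphabet M \<inter> signed_alphabet P = {}"
  shows "w \<circ> t \<in> invs (M \<union> P)"
proof -
  have un: "x \<in> signed_alphabet (M \<union> P) \<longleftrightarrow> x \<in> signed_alphabet M \<or> x \<in> signed_alphabet P" for x
    by (auto simp: signed_alphabet_altdef)
  have "w (t (w (t x))) = x" for x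
  proof (cases "x \<in> signed_alphabet P")
    case True
    then have "t x \<notin> signed_alphabet M" using t disj invs_in by blast
    then show ?thesis using True w t disj invs_fix invs_invol by (metis disjoint_iff)
  next
    case False
    then have "w x \<notin> signed_alphabet P" using w disj invs_in invs_fix by (metis disjoint_iff)
    then show ?thesis using False w t by (simp add: invs_fix invs_invol)
  qed
  then show ?thesis
    using assms by (simp add: invs_iff[of _ "M \<union> P"] un invs_odd invs_fix)
qed

text \<open>A converse to \<open>invs_compose\<close>. Where \<open>w\<close> agrees with the
  involution \<open>t\<close>, composing gives \<open>t (t x) = x\<close>, so the part of
  \<open>w\<close> on \<open>P\<close> is stripped off; elsewhere \<open>t\<close> is the
  identity.\<close>

lemma invs_decompose:
  assumes w: "w \<in> invs N" and t: "t \<in> invs P" and PN: "P \<subseteq> N"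
    and agree: "\<And>x. x \<in> P \<Longrightarrow> w x = t x"
  shows "w \<circ> t \<in> invs (N - P)"
proof -
  have ag: "w x = t x" if "x \<in> signed_alphabet P" for x
    using that agree[of x] agree[of "- x"] invs_odd[OF w, of x] invs_odd[OF t, of x]
    by (auto simp: signed_alphabet_altdef)
  have out: "x \<in> signed_alphabet P \<or> x \<notin> signed_alphabet N" if "x \<notin> signed_alphabet (N - P)" for x
    using that by (auto simp: signed_alphabet_altdef)
  have "w (t x) = x" if "x \<in> signed_alphabet P" for x
    using that ag[of "t x"] t by (simp add: invs_in invs_invol)
  moreover have "w x \<notin> signed_alphabet P" if "x \<notin> signed_alphabet P" for x
    using that ag[of "w x"] invs_invol[OF w, of x] t by (metis invs_in)
  moreover have "signed_alphabet P \<subseteq> signed_alphabet N"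
    using PN by (auto simp: signed_alphabet_altdef)
  ultimately show ?thesis
    unfolding invs_iff o_apply using out
    by (metis invs_fix[OF t] invs_fix[OF w] invs_invol[OF w] invs_odd[OF w]
      invs_odd[OF t] subset_iff)
qed

lemma cyc_in_invs: "0 < i \<Longrightarrow> 0 < j \<Longrightarrow> i \<noteq> j \<Longrightarrow> cyc i j \<in> invs {i, j}"
  and cyc_bar_in_invs: "0 < i \<Longrightarrow> 0 < j \<Longrightarrow> i \<noteq> j \<Longrightarrow> cyc_bar i j \<in> invs {i, j}"
  and neg_in_invs: "neg j \<in> invs {j}"
  by (auto simp: invs_iff cyc_apply cyc_bar_apply neg_apply signed_alphabet_altdef)

lemma invs_mono: "w \<in> invs M \<Longrightarrow> M \<subseteq> N \<Longrightarrow> w \<in> invs N"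
  by (auto simp: invs_iff signed_alphabet_altdef)

section \<open>The blocks of the list\<close>

lemma skip_word:
  assumes "0 < i" "i < int n"
  shows "set (skip_word (int n) i) = {1..int n} - {i, int n}" "length (skip_word (int n) i) = n - 2"
    "relabelling (skip_word (int n) i)"
  using assms by (auto simp: skip_word_def relabelling_def)

definition invs_even :: "int set \<Rightarrow> (int \<Rightarrow> int) set" where
  "invs_even N = {w \<in> invs N. even (neg_count w)}"

lemma (in relabelling) relabel_image_even: "relabel F ` invs_even {1..int (length F)} = invs_even (set F)"
proof -
  have "relabel F ` invs_even {1..int (length F)} =
      {w \<in> relabel F ` invs {1..int (length F)}. even (neg_count w)}"
    using neg_count_relabel by (auto simp: invs_even_def)
  then show ?thesis by (simp add: relabel_image invs_even_def)
qed

text \<open>\<open>K\<close> stands for the relabelled copy of \<open>GCD_list (n - 2)\<close>. The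
  block is analysed from these properties of \<open>K\<close> alone, without the recursion.\<close>

locale pair_block =
  fixes n :: nat and i :: int and K :: "(int \<Rightarrow> int) list"
  assumes i: "0 < i" "i < int n"
    and K: "distinct K" "set K = invs_even ({1..int n} - {i, int n})"
    and hd_K: "K \<noteq> []" "hd K = id"
    and step_K: "successively (a2 ({1..int n} - {i, int n})) K"
begin

abbreviation "M \<equiv> {1..int n} - {i, int n}"
abbreviation "block \<equiv> K \<cdot> cyc i (int n) @ rev K \<cdot> cyc_bar i (int n)"

lemma M_disj: "signed_alphabet M \<inter> signed_alphabet {i, int n} = {}"
  using i by (intro signed_alphabet_disjoint) auto

lemma K_invs: "w \<in> set K \<Longrightarrow> w \<in> invs M"
  by (simp add: K invs_even_def)

lemma fixes_pair:
  assumes "w \<in> invs M" shows "w i = i" "w (int n) = int n" "w (- i) = - i" "w (- int n) = - int n"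
  using assms i by (auto simp: invs_iff signed_alphabet_altdef)

lemma block_at_n:
  assumes "w \<in> set block" shows "w (int n) = i \<or> w (int n) = - i"
  using assms i fixes_pair[OF K_invs] by (auto simp: mult_all_def cyc_apply cyc_bar_apply)

text \<open>If \<open>w\<close> sends \<open>n\<close> to \<open>i\<close> up to sign, then, being
  an odd involution, it sends \<open>i\<close> to \<open>n\<close> with the same sign. Composing
  with the matching cycle strips off this pair, and the number of negative entries changes by 0 or
  2.\<close>

lemma set_block: "set block = {w \<in> invs_even {1..int n}. \<bar>w (int n)\<bar> = i}"
proof (intro equalityI subsetI)
  fix w assume w: "w \<in> set block"
  from w obtain u where u: "u \<in> invs M" "even (neg_count u)"
    and t: "w = u \<circ> cyc i (int n) \<or> w = u \<circ> cyc_bar i (int n)"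
    by (auto simp: mult_all_def K invs_even_def)
  have "M \<union> {i, int n} = {1..int n}" using i by auto
  then have "w \<in> invs {1..int n}"
    using t invs_compose[OF u(1) _ M_disj] cyc_in_invs[of i "int n"] cyc_bar_in_invs[of i "int n"] i by auto
  moreover have "i \<notin> signed_alphabet M" "int n \<notin> signed_alphabet M" using M_disj by (auto simp: signed_alphabet_altdef)
  then have "even (neg_count w)" using t u i by (auto simp: neg_count_cyc neg_count_cyc_bar)
  moreover have "\<bar>w (int n)\<bar> = i" using block_at_n[OF w] i by auto
  ultimately show "w \<in> {w \<in> invs_even {1..int n}. \<bar>w (int n)\<bar> = i}" by (simp add: invs_even_def)
next
  fix w assume "w \<in> {w \<in> invs_even {1..int n}. \<bar>w (int n)\<bar> = i}"
  then have w: "w \<in> invs {1..int n}" "even (neg_count w)" and v: "w (int n) = i \<or> w (int n) = - i"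
    by (auto simp: invs_even_def)
  have wi: "w i = int n" if "w (int n) = i" using invs_invol[OF w(1), of "int n"] that by simp
  have wi': "w i = - int n" if "w (int n) = - i"
    using invs_invol[OF w(1), of "int n"] invs_odd[OF w(1), of i] that by simp
  have notin: "i \<notin> signed_alphabet M" "int n \<notin> signed_alphabet M" using M_disj by (auto simp: signed_alphabet_altdef)
  have sub: "{i, int n} \<subseteq> {1..int n}" using i by auto
  from v show "w \<in> set block"
  proof
    assume v: "w (int n) = i"
    let ?u = "w \<circ> cyc i (int n)"
    have "?u \<in> invs M"
      using w(1) cyc_in_invs sub by (rule invs_decompose) (use i v wi in \<open>auto simp: cyc_apply\<close>)
    then have "neg_count (?u \<circ> cyc i (int n)) = neg_count ?u"
      using i notin by (intro neg_count_cyc) auto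
    \<comment> \<open>The cycle is its own inverse, so multiplying by it again restores
      \<open>w\<close>.\<close>
    moreover have *: "w = ?u \<circ> cyc i (int n)" using i by (auto simp: fun_eq_iff cyc_apply)
    ultimately have "neg_count w = neg_count ?u" by (simp only: *[symmetric])
    then have "?u \<in> set K" using \<open>?u \<in> invs M\<close> w by (simp add: K invs_even_def)
    then have "?u \<circ> cyc i (int n) \<in> set block" by (auto simp: mult_all_def)
    then show ?thesis by (simp only: *[symmetric])
  next
    assume v: "w (int n) = - i"
    let ?u = "w \<circ> cyc_bar i (int n)"
    have "?u \<in> invs M"
      using w(1) cyc_bar_in_invs sub by (rule invs_decompose) (use i v wi' in \<open>auto simp: cyc_bar_apply\<close>)
    then have "neg_count (?u \<circ> cyc_bar i (int n)) = neg_count ?u + 2"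
      using i notin by (intro neg_count_cyc_bar) auto
    moreover have *: "w = ?u \<circ> cyc_bar i (int n)" using i by (auto simp: fun_eq_iff cyc_bar_apply)
    ultimately have "neg_count w = neg_count ?u + 2" by (simp only: *[symmetric])
    then have "?u \<in> set K" using \<open>?u \<in> invs M\<close> w by (simp add: K invs_even_def)
    then have "?u \<circ> cyc_bar i (int n) \<in> set block" by (auto simp: mult_all_def)
    then show ?thesis by (simp only: *[symmetric])
  qed
qed

text \<open>Within each half, right multiplication by a bijection is injective. The halves are told
  apart by the sign of the entry at \<open>n\<close>.\<close>

lemma distinct_block: "distinct block"
proof -
  have "cyc i (int n) (cyc i (int n) x) = x" "cyc_bar i (int n) (cyc_bar i (int n) x) = x" for x
    using i by (auto simp: cyc_apply cyc_bar_apply)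
  then have "surj (cyc i (int n))" "surj (cyc_bar i (int n))" by (metis surjI)+
  then have inj: "inj_on (\<lambda>w :: int \<Rightarrow> int. w \<circ> cyc i (int n)) A" "inj_on (\<lambda>w :: int \<Rightarrow> int. w \<circ> cyc_bar i (int n)) A" for A
    by (auto simp: inj_on_def fun_eq_iff surj_def) metis+
  have "u \<circ> cyc i (int n) \<noteq> v \<circ> cyc_bar i (int n)" if "u \<in> set K" "v \<in> set K" for u v
  proof -
    have "(u \<circ> cyc i (int n)) (int n) \<noteq> (v \<circ> cyc_bar i (int n)) (int n)"
      using fixes_pair(1)[OF K_invs[OF that(1)]] fixes_pair(3)[OF K_invs[OF that(2)]] i
      by (simp add: cyc_apply cyc_bar_apply)
    then show ?thesis by metis
  qed
  then show ?thesis using K(1) inj by (auto simp: mult_all_def distinct_map)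
qed

text \<open>On \<open>M\<close> the cycle \<open>t\<close> is the identity, and on the letters
  \<open>i\<close> and \<open>n\<close> both composites agree with \<open>t\<close>, so the step on
  \<open>M\<close> extends.\<close>

lemma a2_compose:
  assumes "a2 M u v" "u \<in> invs M" "v \<in> invs M" "t = cyc i (int n) \<or> t = cyc_bar i (int n)"
  shows "a2 {1..int n} (u \<circ> t) (v \<circ> t)"
proof (rule a2_mono[OF assms(1)])
  show "(u \<circ> t) x = u x" "(v \<circ> t) x = v x" if "x \<in> M" for x
    using that i assms(4) by (auto simp: cyc_apply cyc_bar_apply)
  show "(u \<circ> t) x = (v \<circ> t) x" if "x \<in> {1..int n} - M" for x
    using that i assms(4) fixes_pair[OF assms(2)] fixes_pair[OF assms(3)]
    by (auto simp: cyc_apply cyc_bar_apply)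
qed auto

text \<open>Since \<open>K\<close> begins with \<open>id\<close> and its second copy is reversed,
  both ends of the block are bare cycles.\<close>

lemma block_nonempty: "block \<noteq> []" and hd_block: "hd block = cyc i (int n)"
  and last_block: "last block = cyc_bar i (int n)"
  using hd_K by (simp_all add: mult_all_def hd_map last_map last_rev)

lemma step_block: "successively (a2 {1..int n}) block"
proof -
  have "successively (a2 {1..int n}) (K \<cdot> cyc i (int n))"
    unfolding mult_all_def successively_map
    by (rule successively_mono[OF step_K]) (blast intro: a2_compose K_invs)
  moreover have "successively (a2 {1..int n}) (rev K \<cdot> cyc_bar i (int n))"
    unfolding mult_all_def successively_map successively_rev
    by (rule successively_mono[OF step_K]) (blast intro: a2_compose K_invs a2_sym)
  \<comment> \<open>At the turning point the factor \<open>last K\<close> is shared, and the two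
    cycles differ only in the signs at positions \<open>i\<close> and \<open>n\<close>.\<close>
  moreover have "a2 {1..int n} (last K \<circ> cyc i (int n)) (last K \<circ> cyc_bar i (int n))"
  proof (rule a2_signs)
    have w: "last K \<in> invs M" using hd_K K_invs by simp
    show "(last K \<circ> cyc_bar i (int n)) x =
      (if x \<in> {i, int n} then - (last K \<circ> cyc i (int n)) x else (last K \<circ> cyc i (int n)) x)"
      if "x \<in> {1..int n}" for x
      using that i fixes_pair[OF w] by (auto simp: cyc_apply cyc_bar_apply)
  qed (use i in auto)
  ultimately show ?thesis
    using hd_K by (simp add: successively_append_iff mult_all_def last_map hd_map hd_rev)
qed

end

text \<open>At positions \<open>i\<close>, \<open>n\<close>, \<open>i + 1\<close> the entries
  \<open>-n\<close>, \<open>-i\<close>, \<open>i + 1\<close> become \<open>i\<close>,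
  \<open>i + 1\<close>, \<open>n\<close>: a rotation in which the two negative entries lose their
  signs.\<close>

lemma a2_between_blocks:
  assumes "0 < i" "i + 1 < int n"
  shows "a2 {1..int n} (cyc_bar i (int n)) (cyc (i + 1) (int n))"
  by (rule a2_rotate[where p = "i" and q = "int n" and r = "i + 1" and S = "{i, i + 1}"])
    (use assms in \<open>auto simp: cyc_apply cyc_bar_apply transpose_def\<close>)

section \<open>The block of involutions sending \<open>n\<close> to itself up to sign\<close>

lemma set_ext_even:
  assumes n: "0 < n" and L: "set L = invs ({1..int n} - {int n})"
  shows "set (ext_even L (int n)) = {w \<in> invs_even {1..int n}. \<bar>w (int n)\<bar> = int n}"
proof -
  let ?M = "{1..int n} - {int n}"
  have un: "?M \<union> {int n} = {1..int n}" using n by auto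
  have disj: "signed_alphabet ?M \<inter> signed_alphabet {int n} = {}"
    using n by (intro signed_alphabet_disjoint) auto
  then have notin: "int n \<notin> signed_alphabet ?M" "- int n \<notin> signed_alphabet ?M"
    by (auto simp: signed_alphabet_altdef)
  show ?thesis
  proof (intro equalityI subsetI)
    fix w assume "w \<in> set (ext_even L (int n))"
    then obtain u where u: "u \<in> invs ?M" and w: "w = (if even (neg_count u) then u else u \<circ> neg (int n))"
      using L by (auto simp: ext_even_def)
    have "u \<circ> neg (int n) \<in> invs {1..int n}" using invs_compose[OF u neg_in_invs disj] un by simp
    moreover have "u \<in> invs {1..int n}" using u by (rule invs_mono) auto
    moreover have "even (neg_count w)" using w u n notin by (simp add: neg_count_neg)
    moreover have "\<bar>w (int n)\<bar> = int n"
      using w n invs_fix[OF u notin(1)] invs_fix[OF u notin(2)] by (auto simp: neg_apply)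
    ultimately show "w \<in> {w \<in> invs_even {1..int n}. \<bar>w (int n)\<bar> = int n}"
      using w by (auto simp: invs_even_def)
  next
    fix w assume "w \<in> {w \<in> invs_even {1..int n}. \<bar>w (int n)\<bar> = int n}"
    then have w: "w \<in> invs {1..int n}" "even (neg_count w)" and v: "w (int n) = int n \<or> w (int n) = - int n"
      by (auto simp: invs_even_def)
    have sub: "{int n} \<subseteq> {1..int n}" using n by auto
    from v show "w \<in> set (ext_even L (int n))"
    proof
      assume "w (int n) = int n"
      \<comment> \<open>Here \<open>n\<close> is fixed, so \<open>id\<close> plays the part of the
        involution split off on the letter \<open>n\<close>.\<close>
      then have "w \<circ> id \<in> invs ?M" using invs_decompose[OF w(1) id_in_invs sub] by simp
      then show ?thesis using w(2) L by (force simp: ext_even_def)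
    next
      assume v: "w (int n) = - int n"
      let ?u = "w \<circ> neg (int n)"
      have u: "?u \<in> invs ?M"
        using w(1) neg_in_invs sub by (rule invs_decompose) (use v in \<open>simp add: neg_apply\<close>)
      have *: "w = ?u \<circ> neg (int n)" by (auto simp: fun_eq_iff neg_apply)
      have "neg_count (?u \<circ> neg (int n)) = Suc (neg_count ?u)"
        using u n notin by (intro neg_count_neg) auto
      then have "neg_count w = Suc (neg_count ?u)" by (simp only: *[symmetric])
      then have "odd (neg_count ?u)" using w(2) by simp
      moreover have "?u \<in> set L" using u L by simp
      ultimately have "?u \<circ> neg (int n) \<in> set (ext_even L (int n))"
        unfolding ext_even_def set_map by (intro image_eqI[of _ _ ?u]) auto
      then show ?thesis by (simp only: *[symmetric])
    qed
  qed
qed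

text \<open>The extension leaves all values away from \<plusminus>n unchanged, and the elements of
  \<open>L\<close> agree on the remaining letters, so each one can be recovered from its
  extension.\<close>

lemma distinct_ext_even:
  assumes n: "0 < n" and L: "set L \<subseteq> invs ({1..int n} - {int n})" and dist: "distinct L"
  shows "distinct (ext_even L (int n))"
proof -
  let ?f = "\<lambda>w. if even (neg_count w) then w else w \<circ> neg (int n)"
  have "inj_on ?f (set L)"
  proof (rule inj_onI, rule ext)
    fix u v x assume "u \<in> set L" "v \<in> set L" and eq: "?f u = ?f v"
    then have uv: "u \<in> invs ({1..int n} - {int n})" "v \<in> invs ({1..int n} - {int n})" using L by auto
    show "u x = v x"
    proof (cases "x \<in> signed_alphabet ({1..int n} - {int n})")
      case True
      then have "x \<noteq> int n" "x \<noteq> - int n" using n by (auto simp: signed_alphabet_altdef)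
      then have "?f w x = w x" for w by (simp add: neg_apply)
      then show ?thesis using fun_cong[OF eq, of x] by simp
    next
      case False
      then show ?thesis using uv by (simp add: invs_fix)
    qed
  qed
  then show ?thesis using dist by (simp add: ext_even_def distinct_map)
qed

text \<open>A step changes the parity iff it changes exactly one sign, so that the sign of
  \<open>n\<close>, which then changes as well, is the second one.\<close>

lemma step_ext_even:
  assumes n: "0 < n" and L: "set L \<subseteq> invs ({1..int n} - {int n})"
    and step: "successively (a2 ({1..int n} - {int n})) L"
  shows "successively (a2 {1..int n}) (ext_even L (int n))"
  unfolding ext_even_def successively_map
proof (rule successively_mono[OF step])
  let ?M = "{1..int n} - {int n}"
  let ?f = "\<lambda>w. if even (neg_count w) then w else w \<circ> neg (int n)"
  fix u v assume "u \<in> set L" "v \<in> set L" and uv: "a2 ?M u v"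
  then have u: "u \<in> invs ?M" and v: "v \<in> invs ?M" using L by auto
  have fx: "u (int n) = int n" "v (int n) = int n" "u (- int n) = - int n" "v (- int n) = - int n"
    using u v n by (auto simp: invs_iff signed_alphabet_altdef)
  have off: "?f w x = w x" if "x \<in> ?M" for w x using that by (auto simp: neg_apply)
  obtain \<tau> S where st: "signed_step ?M \<tau> S u v" using uv by (auto simp: a2_def)
  have par: "even (neg_count v) \<longleftrightarrow> even (neg_count u + card S)"
    using u v _ _ st by (rule signed_step_parity) auto
  show "a2 {1..int n} (?f u) (?f v)"
  proof (cases "even (card S)")
    case True
    \<comment> \<open>With parity unchanged, either both elements or neither receive
      \<open>neg (int n)\<close>. They therefore agree at position \<open>n\<close>, and the
      original step extends.\<close>
    then have "even (neg_count u) \<longleftrightarrow> even (neg_count v)" using par by simp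
    then have "?f u x = ?f v x" if "x \<in> {1..int n} - ?M" for x
      using that fx by (auto simp: neg_apply)
    then show ?thesis using off by (intro a2_mono[OF uv]) blast+
  next
    case odd: False
    then have "card S = 1" using st by (auto simp: signed_step_def le_Suc_eq numeral_2_eq_2)
    moreover have S: "S \<subseteq> ?M" "finite S" and perm: "\<tau> permutes ?M"
      using st short_cycle_permutes by (auto simp: signed_step_def)
    ultimately have "card (insert (int n) S) \<le> 2" by (auto simp: card_insert_if)
    moreover have "?f v x = (if x \<in> insert (int n) S then - ?f u (\<tau> x) else ?f u (\<tau> x))"
      if "x \<in> {1..int n}" for x
    proof (cases "x = int n")
      case True
      then have "\<tau> x = x" using perm by (simp add: permutes_not_in)
      then show ?thesis using True fx par odd by (auto simp: neg_apply)
    next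
      case False
      then have x: "x \<in> ?M" using that by simp
      have "\<tau> x \<in> ?M" using x permutes_in_image[OF perm] by blast
      have "v x = (if x \<in> insert (int n) S then - u (\<tau> x) else u (\<tau> x))"
        using x False st by (simp add: signed_step_def)
      then show ?thesis using off[OF x] off[OF \<open>\<tau> x \<in> ?M\<close>] by (simp only:)
    qed
    moreover have "short_cycle {1..int n} \<tau>"
      using st by (auto simp: signed_step_def intro: short_cycle_mono)
    ultimately have "signed_step {1..int n} \<tau> (insert (int n) S) (?f u) (?f v)"
      using S n unfolding signed_step_def by auto
    then show ?thesis unfolding a2_def by blast
  qed
qed

section \<open>Concatenating blocks\<close>

lemma successively_concat_map:
  assumes "\<And>x. x \<in> set xs \<Longrightarrow> f x \<noteq> []" "\<And>x. x \<in> set xs \<Longrightarrow> successively R (f x)"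
    and "successively (\<lambda>x y. R (last (f x)) (hd (f y))) xs"
  shows "successively R (concat (map f xs))"
  using assms
proof (induction xs)
  case (Cons x xs)
  then have "successively R (concat (map f xs))" by (auto simp: successively_Cons)
  moreover have "concat (map f xs) = [] \<or> R (last (f x)) (hd (concat (map f xs)))"
    using Cons.prems by (cases xs) (auto simp: successively_Cons)
  ultimately show ?case using Cons.prems by (simp add: successively_append_iff)
qed simp

lemma successively_upto:
  assumes "\<And>x. a \<le> x \<Longrightarrow> x < b \<Longrightarrow> R x (x + 1)" shows "successively R [a..b]"
  unfolding successively_conv_nth
proof (intro allI impI)
  fix k assume "Suc k < length [a..b]"
  then show "R ([a..b] ! k) ([a..b] ! Suc k)" using assms[of "a + int k"] by (simp add: algebra_simps)
qed

lemma distinct_concat_map: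
  assumes "distinct xs" "\<And>x. x \<in> set xs \<Longrightarrow> distinct (f x)"
    and "\<And>x y. x \<in> set xs \<Longrightarrow> y \<in> set xs \<Longrightarrow> x \<noteq> y \<Longrightarrow> set (f x) \<inter> set (f y) = {}"
  shows "distinct (concat (map f xs))"
  using assms
proof (induction xs)
  case (Cons x xs)
  then have "set (f x) \<inter> set (f y) = {}" if "y \<in> set xs" for y using that by force
  with Cons show ?case by auto
qed simp

lemma invs_range:
  assumes "w \<in> invs {1..int n}" "0 < n" shows "0 < \<bar>w (int n)\<bar>" "\<bar>w (int n)\<bar> \<le> int n"
proof -
  have "int n \<in> signed_alphabet {1..int n}" using assms by (auto simp: signed_alphabet_def)
  then have "w (int n) \<in> signed_alphabet {1..int n}" using invs_in[OF assms(1)] by blast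
  then show "0 < \<bar>w (int n)\<bar>" "\<bar>w (int n)\<bar> \<le> int n" by (auto simp: signed_alphabet_altdef)
qed

section \<open>Assembling the blocks into a cyclic list\<close>

theorem theorem3p6:
  fixes n :: nat
  assumes "n \<ge> 3"
    and "lists_exactly_once (GCD_list (n - 2)) (involutions_in (SD (n - 2)))"
    and "lists_exactly_once (GCB_list (n - 1)) (involutions_in (SB (n - 1)))"
    and "property_A1 (n - 2) (GCD_list (n - 2))" and "property_A2 (n - 2) (GCD_list (n - 2))"
    and "property_A1 (n - 1) (GCB_list (n - 1))" and "property_A2 (n - 1) (GCB_list (n - 1))"
  shows "lists_exactly_once (GCD_list n) (involutions_in (SD n))
    \<and> property_A1 n (GCD_list n)
    \<and> property_A2 n (GCD_list n)
    \<and> cyclic_A2 n (GCD_list n)"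
proof -
  define D where "D = GCD_list (n - 2)"
  define B where "B = GCB_list (n - 1)"
  have D: "distinct D" "set D = invs_even {1..int (n - 2)}" "D \<noteq> []" "hd D = id"
    "successively (a2 {1..int (n - 2)}) D"
    using assms(2,4,5)
    by (auto simp: D_def lists_exactly_once_def property_A1_def property_A2_iff invs_SD invs_even_def)
  \<comment> \<open>As \<open>n - 1\<close> is at least 2, A1 determines the last element of
    \<open>B\<close> up to the choice between two cycles; the junction with the next block depends
    on it.\<close>
  have B: "distinct B" "set B = invs {1..int (n - 1)}" "B \<noteq> []" "hd B = id"
    "successively (a2 {1..int (n - 1)}) B"
    "last B = cyc (int n - 2) (int n - 1) \<or> last B = cyc_bar (int n - 2) (int n - 1)"
    using assms(1,3,6,7)
    by (auto simp: B_def lists_exactly_once_def property_A1_def property_A2_iff invs_SB of_nat_diff)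
  define K where "K i = map (relabel (skip_word (int n) i)) D" for i
  define blk where "blk i = K i \<cdot> cyc i (int n) @ rev (K i) \<cdot> cyc_bar i (int n)" for i
  define F where "F = [2..int n - 1] @ [1]"
  define L where "L = map (relabel F) B"
  have GCD: "GCD_list n = ext_even L (int n) @ concat (map blk [1..int n - 1])"
  proof -
    have "blk = (\<lambda>i. let L = map (relabel (skip_word (int n) i)) (GCD_list (n - 2))
        in L \<cdot> cyc i (int n) @ rev L \<cdot> cyc_bar i (int n))"
      by (simp add: fun_eq_iff blk_def K_def D_def Let_def)
    then show ?thesis using assms(1) by (simp add: GCD_list.simps[of n] F_def L_def B_def)
  qed

  have blocks: "pair_block n i (K i)" if i: "0 < i" "i < int n" for i
  proof -
    interpret relabelling "skip_word (int n) i" using i by (rule skip_word)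
    note [simp] = skip_word[OF i]
    have inv: "set D \<subseteq> invs {1..int (n - 2)}" by (auto simp: D invs_even_def)
    show ?thesis
    proof
      show "distinct (K i)" using D(1) inv relabel_inj by (auto simp: K_def distinct_map intro: inj_on_subset)
      show "set (K i) = invs_even ({1..int n} - {i, int n})"
        using relabel_image_even by (simp add: K_def D)
      show "K i \<noteq> []" "hd (K i) = id" using D by (simp_all add: K_def hd_map relabel_id)
      show "successively (a2 ({1..int n} - {i, int n})) (K i)"
        unfolding K_def successively_map
        by (rule successively_mono[OF D(5)]) (use a2_relabel inv in auto)
    qed (use i in auto)
  qed
  have blk_set: "set (blk i) = {w \<in> invs_even {1..int n}. \<bar>w (int n)\<bar> = i}"
    and blk_distinct: "distinct (blk i)" and blk_step: "successively (a2 {1..int n}) (blk i)"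
    and blk_ne: "blk i \<noteq> []" and blk_hd: "hd (blk i) = cyc i (int n)"
    and blk_last: "last (blk i) = cyc_bar i (int n)" if "0 < i" "i < int n" for i
    using pair_block.set_block[OF blocks[OF that]] pair_block.distinct_block[OF blocks[OF that]]
      pair_block.step_block[OF blocks[OF that]] pair_block.block_nonempty[OF blocks[OF that]]
      pair_block.hd_block[OF blocks[OF that]] pair_block.last_block[OF blocks[OF that]]
    by (simp_all only: blk_def simp_thms)

  interpret F: relabelling F by standard (auto simp: F_def)
  have F: "length F = n - 1" "set F = {1..int n} - {int n}" using assms(1) by (auto simp: F_def)
  have L: "set L = invs ({1..int n} - {int n})" "distinct L" "L \<noteq> []" "hd L = id"
    using B F.relabel_image F.relabel_inj F by (simp_all add: L_def distinct_map hd_map F.relabel_id)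
  have L_step: "successively (a2 ({1..int n} - {int n})) L"
    unfolding L_def successively_map
    by (rule successively_mono[OF B(5)]) (use F.a2_relabel F B in auto)
  \<comment> \<open>The word \<open>F\<close> sends \<open>n - 2\<close> to \<open>n - 1\<close> and
    \<open>n - 1\<close> to 1, so the final cycle of \<open>B\<close> becomes one on the letters
    \<open>n - 1\<close> and 1.\<close>
  have last_L: "last L = cyc (int n - 1) 1 \<or> last L = cyc_bar (int n - 1) 1"
  proof -
    have "word_map F (int n - 2) = int n - 1" "word_map F (int n - 1) = 1"
      using assms(1) by (auto simp: F_def word_map_def nth_append)
    then show ?thesis
      using B F F.relabel_cyc[of "int n - 2" "int n - 1"] assms(1) by (auto simp: L_def last_map)
  qed
  define E where "E = ext_even L (int n)"
  have E: "set E = {w \<in> invs_even {1..int n}. \<bar>w (int n)\<bar> = int n}" "distinct E"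
    "successively (a2 {1..int n}) E" "E \<noteq> []"
    using set_ext_even distinct_ext_even step_ext_even L L_step assms(1) by (auto simp: E_def ext_even_def)
  have nc: "neg_count id = 0" by (simp add: neg_count_def)
  have hd_E: "hd E = id" using L by (simp add: E_def ext_even_def hd_map nc)
  have last_E: "last E = last L"
  proof -
    \<comment> \<open>The last element has 0 or 2 negative entries, computed by composing a cycle
      with \<open>id\<close> over the empty alphabet. Hence its extension leaves \<open>n\<close>
      fixed.\<close>
    have "even (neg_count (last L))"
      using last_L assms(1) nc neg_count_cyc[OF id_in_invs, of "int n - 1" 1 "{}"]
        neg_count_cyc_bar[OF id_in_invs, of "{}" "int n - 1" 1] by (auto simp: signed_alphabet_def)
    then show ?thesis using L by (simp add: E_def ext_even_def last_map)
  qed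

  define C where "C = concat (map blk [1..int n - 1])"
  have C_ends: "C \<noteq> []" "hd C = cyc 1 (int n)" "last C = cyc_bar (int n - 1) (int n)"
  proof -
    have "C = blk 1 @ concat (map blk [2..int n - 1])"
      using assms(1) by (simp add: C_def upto_rec1[of 1])
    then show "C \<noteq> []" "hd C = cyc 1 (int n)"
      using blk_ne[of 1] blk_hd[of 1] assms(1) by simp_all
    have "C = concat (map blk [1..int n - 2]) @ blk (int n - 1)"
      using assms(1) by (simp add: C_def upto_rec2[of 1])
    then show "last C = cyc_bar (int n - 1) (int n)"
      using blk_ne[of "int n - 1"] blk_last[of "int n - 1"] assms(1) by simp
  qed
  have C_set: "set C = {w \<in> invs_even {1..int n}. \<bar>w (int n)\<bar> < int n}"
  proof -
    have "set C = (\<Union>i\<in>{1..int n - 1}. set (blk i))" by (simp add: C_def)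
    also have "\<dots> = {w \<in> invs_even {1..int n}. \<bar>w (int n)\<bar> \<in> {1..int n - 1}}"
      using blk_set by auto
    also have "\<dots> = {w \<in> invs_even {1..int n}. \<bar>w (int n)\<bar> < int n}"
      \<comment> \<open>The lower bound 1 is automatic, because the entry at \<open>n\<close> is a
        nonzero integer.\<close>
      using invs_range assms(1) by (fastforce simp: invs_even_def)
    finally show ?thesis .
  qed
  have C_distinct: "distinct C" unfolding C_def
    by (rule distinct_concat_map) (auto simp: blk_distinct blk_set)
  have C_step: "successively (a2 {1..int n}) C" unfolding C_def
  proof (rule successively_concat_map)
    show "successively (\<lambda>i j. a2 {1..int n} (last (blk i)) (hd (blk j))) [1..int n - 1]"
      by (rule successively_upto) (simp add: blk_hd blk_last a2_between_blocks)
  qed (auto simp: blk_ne blk_step)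
  \<comment> \<open>At positions 1, \<open>n\<close>, \<open>n - 1\<close> the entries
    \<open>n - 1\<close>, \<open>n\<close>, 1 rotate to \<open>n\<close>, 1, \<open>n - 1\<close>.
    For the barred cycle the entries \<open>n - 1\<close> and 1 start out negative, and
    \<open>S\<close> consists of the positions they reach.\<close>
  have join: "a2 {1..int n} (last E) (hd C)"
    unfolding last_E C_ends
  proof (rule a2_rotate[where p = 1 and q = "int n" and r = "int n - 1"
        and S = "if last L = cyc (int n - 1) 1 then {} else {int n, int n - 1}"])
    fix x assume "x \<in> {1..int n}"
    then show "cyc 1 (int n) x = (if x \<in> (if last L = cyc (int n - 1) 1 then {} else {int n, int n - 1})
        then - last L ((transpose 1 (int n) \<circ> transpose (int n) (int n - 1)) x)
        else last L ((transpose 1 (int n) \<circ> transpose (int n) (int n - 1)) x))"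
      using last_L assms(1) by (auto simp: cyc_apply cyc_bar_apply transpose_def)
  qed (use assms(1) in auto)
  \<comment> \<open>The final word ends in \<open>-n\<close>, \<open>-(n - 1)\<close>; exchanging
    these two entries and changing both signs gives the identity.\<close>
  have close: "a2 {1..int n} (last C) id"
    unfolding C_ends
    by (rule a2_swap[where p = "int n - 1" and q = "int n" and S = "{int n - 1, int n}"])
      (use assms(1) in \<open>auto simp: cyc_bar_apply transpose_def\<close>)

  have G: "GCD_list n = E @ C" by (simp add: GCD E_def C_def)
  have "lists_exactly_once (GCD_list n) (involutions_in (SD n))"
  proof -
    \<comment> \<open>The absolute value of the entry at \<open>n\<close> is at most
      \<open>n\<close>: equality gives the elements of \<open>E\<close>, strict inequality those of
      \<open>C\<close>. The same dichotomy makes the two lists disjoint.\<close>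
    have "set (E @ C) = invs_even {1..int n}"
      using invs_range assms(1) by (fastforce simp: E C_set invs_even_def)
    then show ?thesis
      using E(2) C_distinct by (auto simp: lists_exactly_once_def G invs_SD invs_even_def E(1) C_set)
  qed
  moreover have "property_A1 n (GCD_list n)"
    using E C_ends hd_E by (simp add: property_A1_def G)
  moreover have "property_A2 n (GCD_list n)"
    using E C_step join by (simp add: property_A2_iff G successively_append_iff)
  moreover have "cyclic_A2 n (GCD_list n)"
    using E hd_E C_ends(1) close by (simp add: cyclic_A2_def G A2_step_one_line)
  ultimately show ?thesis by blast
qed

end
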